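(* There exists a universal constant $C>1$ such that, for every analytic map $\phi\colon\mathbb{D}\to\mathbb{D}$, one has $$\frac1C\,\rho_{\phi,2}(h/C)\le\sup_{w\in\mathbb{D},\,|w|\ge1-h}N_{\phi,2}(w)\le C\,\rho_{\phi,2}(Ch)$$ for all $h\in(0,1)$ small enough (the smallness threshold may depend on $\phi$).
   Context: $\mathbb{D}$ is the open unit disk, $\mathbb{T}$ the unit circle, $\mathcal{A}$ the normalized area measure $dx\,dy/\pi$. For $\xi\in\mathbb{T}$ and $0<h\le 1$, $W(\xi,h)=\{z\in\mathbb{D}:|z|\ge1-h,\ |\arg(z\bar\xi)|\le\pi h\}$. $\rho_{\phi,2}(h)=\sup_{\xi\in\mathbb{T}}\mathcal{A}(\{z\in\mathbb{D}:\phi(z)\in W(\xi,h)\})$. The Nevanlinna counting function of order $2$ is $N_{\phi,2}(w)=\sum_{\phi(z)=w}(\log(1/|z|))^2$ for $w\in\mathbb{D}\setminus\{\phi(0)\}$, each preimage counted with multiplicity (the sum is $0$ if $w\notin\phi(\mathbb{D})$), and $N_{\phi,2}(\phi(0))=0$. *)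

theory Defs
  imports "HOL-Complex_Analysis.Complex_Analysis"
begin

definition area_meas :: "complex set \<Rightarrow> real" where
  "area_meas S = measure lebesgue S / pi"

definition carleson_window :: "complex \<Rightarrow> real \<Rightarrow> complex set" where
  "carleson_window \<xi> h =
     {z. norm z < 1 \<and> norm z \<ge> 1 - h \<and> \<bar>Arg (z * cnj \<xi>)\<bar> \<le> pi * h}"

definition rho2 :: "(complex \<Rightarrow> complex) \<Rightarrow> real \<Rightarrow> real" where
  "rho2 \<phi> h = (SUP \<xi>\<in>sphere 0 1.
       area_meas {z. norm z < 1 \<and> \<phi> z \<in> carleson_window \<xi> h})"

text \<open>Nevanlinna counting function of order 2 (valued in [0,infinity]); preimages counted
  with multiplicity given by the zero order of phi - w; N(phi(0)) = 0 by convention.\<close>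
definition nevanlinna2 :: "(complex \<Rightarrow> complex) \<Rightarrow> complex \<Rightarrow> ennreal" where
  "nevanlinna2 \<phi> w =
     (if w = \<phi> 0 then 0
      else (\<Sum>\<^sub>\<infinity> z\<in>{z. norm z < 1 \<and> \<phi> z = w}.
              ennreal (real (nat (zorder (\<lambda>u. \<phi> u - w) z)) * (ln (1 / norm z))\<^sup>2)))"

end

(* Writing log|phi - w| for the integrand, Jensen's formula integrated over the disc of radius r
   (rather than over its boundary) gives
     J(w) = (integral over |z| < r of log|phi(z) - w|) - pi r^2 log|phi(0) - w|
          = sum over preimages a of w of the weight G_r(|a|),
   where G_R(s) is the integral over |z| < R of log^+(|z|/s), and G_r(|a|) is comparable to
   (log(1/|a|))^2 as r tends to 1. The same function G is the defect in the mean value property of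
   the logarithm, so Fubini's theorem yields, for a disc B(c,R) avoiding phi(0),
     (integral of J over B(c,R)) = pi R^2 J(c) + (integral over |z| < r of G_R(|phi(z) - c|)).
   Both estimates follow by taking c = P = (1+h) xi, where J(P) = 0 because P is outside the disc, and
   R comparable to h: then G_R(|phi - P|) is supported where phi lies in a window of size comparable
   to h, and is bounded below on a smaller window. For the upper estimate J(w) is first bounded by the
   average of J over B(w,h), since the integral of G_h(|phi - w|) is nonnegative, and then B(w,h) is
   enlarged to B(P,3h). *)

theory Submission
  imports Defs
begin

text \<open>Averaging over a disc instead of a circle is what produces the square: the circle weight
  log(r/s) of Jensen's formula vanishes to first order at s = r, whereas G_r vanishes to second
  order. All work is done at radii r < 1, where a value w other than phi(0) has finitely many
  preimages, with constants that do not depend on r; only at the end does r tend to 1. The threshold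
  on h keeps phi(0) out of the discs about P and w, so that log|phi(0) - .| has no defect there; in
  the upper estimate it also forces |a| > 1/2 for every preimage a of w, which makes G_r(|a|)
  bounded below by a multiple of (log(r/|a|))^2. A centre outside the unit disc is allowed because
  Jensen's formula holds for every w other than phi(0), whether or not w is in the range of phi.
  Means over discs are reduced to means over circles by rotation invariance and Fubini, without
  polar coordinates. The constant 100 is generous: the estimates give the factors 192/7 (lower) and
  72 (upper).\<close>

section \<open>Rotation invariance of Lebesgue measure on the complex plane\<close>

text \<open>Identifies \<open>real ^ 2\<close> with the complex plane, so that the theorems on
  measures of orthogonal images in \<open>real ^ 2\<close> can be carried over.\<close>

definition complex_of_vec :: "real ^ 2 \<Rightarrow> complex" where
  "complex_of_vec v = Complex (v $ 1) (v $ 2)"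

lemma continuous_complex_of_vec: "continuous_on UNIV complex_of_vec"
  unfolding complex_of_vec_def Complex_eq by (intro continuous_intros)

lemma measurable_complex_of_vec [measurable]: "complex_of_vec \<in> borel_measurable borel"
  by (rule borel_measurable_continuous_onI[OF continuous_complex_of_vec])

lemma distr_complex_of_vec: "distr lborel borel complex_of_vec = lborel"
proof (rule lborel_eqI[symmetric])
  fix l u :: complex
  assume le: "\<And>b. b \<in> Basis \<Longrightarrow> l \<bullet> b \<le> u \<bullet> b"
  define l' u' :: "real ^ 2" where "l' = vector [Re l, Im l]" and "u' = vector [Re u, Im u]"
  have le': "Re l \<le> Re u" "Im l \<le> Im u"
    using le[of 1] le[of \<i>] by (auto simp: Basis_complex_def)
  have "complex_of_vec -` box l u = box l' u'"
    by (auto simp: complex_of_vec_def l'_def u'_def mem_box_cart in_box_complex_iff forall_2)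
  then have "emeasure (distr lborel borel complex_of_vec) (box l u) = emeasure lborel (box l' u')"
    by (subst emeasure_distr) auto
  also have "\<dots> = ennreal (\<Prod>b\<in>Basis. (u' - l') \<bullet> b)"
  proof (rule emeasure_lborel_box)
    have "l' $ i \<le> u' $ i" for i
      using le' exhaust_2[of i] by (auto simp: l'_def u'_def)
    then show "l' \<bullet> b \<le> u' \<bullet> b" if "b \<in> Basis" for b
      using that by (auto simp: Basis_vec_def inner_axis)
  qed
  also have "(\<Prod>b\<in>Basis. (u' - l') \<bullet> b) = (Re u - Re l) * (Im u - Im l)"
  proof -
    have *: "(Basis :: (real ^ 2) set) = {axis 1 1, axis 2 1}"
      by (auto simp: Basis_vec_def UNIV_2)
    have "axis 1 1 \<noteq> (axis 2 1 :: real ^ 2)"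
      by (simp add: axis_eq_axis)
    then show ?thesis
      unfolding * by (simp add: inner_axis l'_def u'_def)
  qed
  also have "\<dots> = (\<Prod>b\<in>Basis. (u - l) \<bullet> b)"
    by (simp add: Basis_complex_def)
  finally show "emeasure (distr lborel borel complex_of_vec) (box l u) = (\<Prod>b\<in>Basis. (u - l) \<bullet> b)" .
qed simp

text \<open>Lebesgue measure is determined by its values on boxes. The preimage of a box under
  multiplication by \<open>c\<close> is its image under multiplication by \<open>cnj c\<close>, an
  orthogonal map of \<open>real ^ 2\<close>.\<close>

lemma distr_lborel_rotation:
  fixes c :: complex
  assumes "norm c = 1"
  shows "distr lborel borel ((*) c) = lborel"
proof (rule lborel_eqI[symmetric])
  fix l u :: complex
  assume le: "\<And>b. b \<in> Basis \<Longrightarrow> l \<bullet> b \<le> u \<bullet> b"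
  have c0: "c \<noteq> 0" using assms by auto
  have cc: "cnj c * c = 1" using assms complex_norm_square[of c] by (simp add: mult.commute)
  \<comment> \<open>\<open>F\<close> is multiplication by \<open>cnj c\<close>, the inverse of
    \<open>c\<close>, read in real coordinates; the inverse appears because the measure theorem
    concerns images while \<open>distr\<close> asks for preimages.\<close>
  define F :: "real ^ 2 \<Rightarrow> real ^ 2" where
    "F v = (let z = cnj c * complex_of_vec v in vector [Re z, Im z])" for v
  have F: "complex_of_vec (F v) = cnj c * complex_of_vec v" for v
    by (simp add: F_def Let_def complex_of_vec_def complex_eq_iff)
  have inj: "complex_of_vec v = complex_of_vec w \<longleftrightarrow> v = w" for v w
    by (auto simp: complex_of_vec_def vec_eq_iff forall_2)
  have surj: "\<exists>v. complex_of_vec v = z" for z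
    by (rule exI[of _ "vector [Re z, Im z]"]) (simp add: complex_of_vec_def)
  have norm: "norm (complex_of_vec v) = norm v" for v
    by (simp add: complex_of_vec_def cmod_def norm_vec_def L2_set_def UNIV_2)
  have orth: "orthogonal_transformation F"
    unfolding orthogonal_transformation
  proof (intro conjI allI)
    have add: "complex_of_vec (v + w) = complex_of_vec v + complex_of_vec w" for v w
      by (simp add: complex_of_vec_def complex_eq_iff)
    have scale: "complex_of_vec (r *\<^sub>R v) = r *\<^sub>R complex_of_vec v" for r v
      by (simp add: complex_of_vec_def complex_eq_iff)
    show "linear F"
      by (rule linearI; rule inj[THEN iffD1]) (simp_all add: F add scale algebra_simps)
    show "norm (F v) = norm v" for v
      using assms by (simp flip: norm add: F norm_mult)
  qed
  define B where "B = complex_of_vec -` box l u"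
  have B: "B \<in> sets borel"
    unfolding B_def using measurable_sets[OF measurable_complex_of_vec, of "box l u"] by simp
  have eB: "emeasure lborel B = emeasure lborel (box l u)"
    using emeasure_distr[of complex_of_vec lborel borel "box l u"]
    by (simp add: B_def distr_complex_of_vec)
  have Bm: "B \<in> lmeasurable"
  proof (rule fmeasurableI)
    show "emeasure lebesgue B < \<infinity>" using B eB by (simp add: emeasure_lborel_box_eq)
  qed (use B in auto)
  have eq: "complex_of_vec -` ((*) c -` box l u) = F ` B"
  proof (intro equalityI subsetI)
    fix v assume v: "v \<in> complex_of_vec -` ((*) c -` box l u)"
    obtain w where w: "complex_of_vec w = c * complex_of_vec v" using surj by blast
    have "F w = v" by (subst inj[symmetric]) (simp add: F w cc flip: mult.assoc)
    moreover have "w \<in> B" using v w by (simp add: B_def)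
    ultimately show "v \<in> F ` B" by blast
  next
    fix v assume "v \<in> F ` B"
    then show "v \<in> complex_of_vec -` ((*) c -` box l u)"
      using cc by (auto simp: F B_def mult.assoc[symmetric] mult.commute)
  qed
  have m: "(*) c -` box l u \<in> sets borel"
    using measurable_sets[of "(*) c" borel borel "box l u"] by simp
  have mF: "F ` B \<in> sets borel"
    unfolding eq[symmetric] using measurable_sets[OF measurable_complex_of_vec m] by simp
  have "emeasure (distr lborel borel ((*) c)) (box l u) = emeasure lborel ((*) c -` box l u)"
    by (subst emeasure_distr) auto
  also have "\<dots> = emeasure lborel (F ` B)"
    using m by (subst distr_complex_of_vec[symmetric], subst emeasure_distr) (auto simp: eq)
  also have "\<dots> = emeasure lebesgue (F ` B)" using mF by simp
  also have "\<dots> = ennreal (measure lebesgue (F ` B))"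
    using measurable_orthogonal_image[OF orth Bm] by (rule emeasure_eq_measure2)
  also have "\<dots> = ennreal (measure lebesgue B)"
    using measure_orthogonal_image[OF orth Bm] by simp
  also have "\<dots> = emeasure lebesgue B"
    using Bm by (rule emeasure_eq_measure2[symmetric])
  also have "\<dots> = emeasure lborel (box l u)" using B eB by simp
  finally show "emeasure (distr lborel borel ((*) c)) (box l u) = (\<Prod>b\<in>Basis. (u - l) \<bullet> b)"
    using le by (simp add: emeasure_lborel_box)
qed simp

lemma
  fixes f :: "complex \<Rightarrow> 'a :: {banach, second_countable_topology}"
  assumes "norm c = 1" "f \<in> borel_measurable borel"
  shows integral_lborel_rotation: "(LINT z|lborel. f (c * z)) = (LINT z|lborel. f z)"
    and integrable_lborel_rotation_iff: "integrable lborel (\<lambda>z. f (c * z)) \<longleftrightarrow> integrable lborel f"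
  using assms integral_distr[of "(*) c" lborel borel f] integrable_distr_eq[of "(*) c" lborel borel f]
  by (simp_all add: distr_lborel_rotation)

section \<open>Integrability of the logarithm\<close>

lemma measure_ball_complex: "R \<ge> 0 \<Longrightarrow> measure lborel (ball (c::complex) R) = pi * R\<^sup>2"
  by (simp add: content_ball unit_ball_vol_2)

lemma emeasure_ball_complex: "R \<ge> 0 \<Longrightarrow> emeasure lborel (ball (c::complex) R) = ennreal (pi * R\<^sup>2)"
  by (simp add: emeasure_ball unit_ball_vol_2)

text \<open>On the annulus between the radii 2^-(n+1) and 2^-n one has -ln|z| <= 1/|z| <= 2^(n+1),
  so the n-th term alone dominates. At the origin the convention \<open>ln 0 = 0\<close> makes the
  left side vanish.\<close>

lemma neg_ln_le_dyadic:
  fixes z :: complex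
  shows "ennreal (max 0 (- ln (norm z))) \<le> (\<Sum>n. ennreal (2 ^ Suc n) * indicator (ball 0 ((1/2) ^ n)) z)"
proof (cases "z = 0 \<or> norm z \<ge> 1")
  case True
  then have "max 0 (- ln (norm z)) = 0" by auto
  then show ?thesis by simp
next
  case False
  then have z: "0 < norm z" "norm z < 1" by auto
  obtain m where m: "(1/2) ^ m < norm z" using real_arch_pow_inv[OF z(1), of "1/2"] by auto
  define n where "n = (LEAST n. (1/2) ^ Suc n \<le> norm z)"
  have ex: "(1/2) ^ Suc m \<le> norm z"
    using m z by (simp only: power_Suc)
  have n: "(1/2) ^ Suc n \<le> norm z" unfolding n_def by (rule LeastI) (rule ex)
  have n': "norm z < (1/2) ^ n"
  proof (cases n)
    case (Suc k)
    then have "\<not> (1/2) ^ Suc k \<le> norm z" using not_less_Least[of k "\<lambda>n. (1/2) ^ Suc n \<le> norm z"] n_def by auto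
    then show ?thesis using Suc by simp
  qed (use z in auto)
  have "- ln (norm z) = ln (1 / norm z)" using z by (simp add: ln_div)
  also have "\<dots> \<le> 1 / norm z" using ln_le_minus_one[of "1 / norm z"] z by simp
  also have "\<dots> \<le> 1 / (1/2) ^ Suc n" using n z by (intro divide_left_mono) auto
  also have "\<dots> = 2 ^ Suc n" by (simp add: power_divide)
  finally have "max 0 (- ln (norm z)) \<le> 2 ^ Suc n" by simp
  then have "ennreal (max 0 (- ln (norm z))) \<le> ennreal (2 ^ Suc n) * indicator (ball 0 ((1/2) ^ n)) z"
    using n' by (simp add: indicator_def ennreal_leI)
  also have "\<dots> = (\<Sum>k\<in>{n}. ennreal (2 ^ Suc k) * indicator (ball 0 ((1/2) ^ k)) z)"
    by (simp only: sum.insert finite.emptyI empty_iff not_False_eq_True sum.empty add_0_right)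
  also have "\<dots> \<le> (\<Sum>n. ennreal (2 ^ Suc n) * indicator (ball 0 ((1/2) ^ n)) z)"
    by (rule sum_le_suminf) auto
  finally show ?thesis .
qed

text \<open>After a translation, the n-th dyadic term integrates to 2^(n+1) * pi * 4^-n = 2 pi 2^-n,
  and these sum to 4 pi, uniformly in \<open>w\<close>.\<close>

lemma nn_integral_neg_ln_norm_diff_le:
  fixes w :: complex
  shows "(\<integral>\<^sup>+z. ennreal (max 0 (- ln (norm (w - z)))) \<partial>lborel) \<le> ennreal (4 * pi)"
proof -
  have "(\<integral>\<^sup>+z. ennreal (max 0 (- ln (norm (w - z)))) \<partial>lborel)
      = (\<integral>\<^sup>+z. ennreal (max 0 (- ln (norm (- w + z)))) \<partial>lborel)"
    by (simp add: norm_minus_commute)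
  also have "\<dots> = (\<integral>\<^sup>+z. ennreal (max 0 (- ln (norm z))) \<partial>distr lborel borel ((+) (- w)))"
    by (subst nn_integral_distr) auto
  also have "\<dots> = (\<integral>\<^sup>+z. ennreal (max 0 (- ln (norm (z::complex)))) \<partial>lborel)"
    by (simp add: lborel_distr_plus)
  also have "\<dots> \<le> (\<integral>\<^sup>+z. (\<Sum>n. ennreal (2 ^ Suc n) * indicator (ball (0::complex) ((1/2) ^ n)) z) \<partial>lborel)"
    by (intro nn_integral_mono neg_ln_le_dyadic)
  also have "\<dots> = (\<Sum>n. (\<integral>\<^sup>+z. ennreal (2 ^ Suc n) * indicator (ball (0::complex) ((1/2) ^ n)) z \<partial>lborel))"
    by (rule nn_integral_suminf) (intro borel_measurable_times_ennreal borel_measurable_indicator, auto)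
  also have "\<dots> = (\<Sum>n. ennreal (2 * pi * (1/2) ^ n))"
  proof (intro suminf_cong)
    fix n :: nat
    have "(\<integral>\<^sup>+z. ennreal (2 ^ Suc n) * indicator (ball (0::complex) ((1/2) ^ n)) z \<partial>lborel)
        = ennreal (2 ^ Suc n) * ennreal (pi * ((1/2) ^ n)\<^sup>2)"
      by (subst nn_integral_cmult_indicator) (auto simp: emeasure_ball_complex)
    also have "\<dots> = ennreal (2 ^ Suc n * (pi * ((1/2) ^ n)\<^sup>2))"
      by (rule ennreal_mult[symmetric]) auto
    also have "2 ^ Suc n * (pi * ((1/2) ^ n)\<^sup>2) = 2 * pi * (1/2) ^ n"
      by (simp add: power_divide power2_eq_square field_simps)
    finally show "(\<integral>\<^sup>+z. ennreal (2 ^ Suc n) * indicator (ball (0::complex) ((1/2) ^ n)) z \<partial>lborel)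
        = ennreal (2 * pi * (1/2) ^ n)" .
  qed
  also have "\<dots> = ennreal (4 * pi)"
  proof (rule suminf_ennreal_eq)
    have "(\<lambda>n. 2 * pi * (1/2::real) ^ n) sums (2 * pi * (1 / (1 - 1/2)))"
      by (intro sums_mult geometric_sums) auto
    then show "(\<lambda>n. 2 * pi * (1/2::real) ^ n) sums (4 * pi)" by simp
  qed auto
  finally show ?thesis .
qed

text \<open>The bound depends on \<open>w\<close> only through the factor \<open>L\<close>, which makes double
  logarithmic integrals absolutely convergent.\<close>

lemma
  fixes w c :: complex
  assumes R: "R \<ge> 0" and L: "\<And>z. z \<in> ball c R \<Longrightarrow> norm (w - z) \<le> L"
  shows set_integrable_ln_norm_diff: "set_integrable lborel (ball c R) (\<lambda>z. ln (norm (w - z)))"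
    and set_integral_abs_ln_norm_diff_le:
      "(LINT z:ball c R|lborel. \<bar>ln (norm (w - z))\<bar>) \<le> 4 * pi + \<bar>L\<bar> * pi * R\<^sup>2"
proof -
  let ?f = "\<lambda>z. indicator (ball c R) z *\<^sub>R ln (norm (w - z))"
  have le: "ennreal (norm (?f z)) \<le> ennreal (max 0 (- ln (norm (w - z)))) + ennreal \<bar>L\<bar> * indicator (ball c R) z" for z
  proof (cases "z \<in> ball c R")
    case True
    have "\<bar>ln (norm (w - z))\<bar> \<le> max 0 (- ln (norm (w - z))) + \<bar>L\<bar>"
    proof (cases "w = z")
      case False
      then have "ln (norm (w - z)) \<le> L" using L[OF True] ln_le_minus_one[of "norm (w - z)"] by simp
      then show ?thesis by auto
    qed auto
    then have "ennreal \<bar>ln (norm (w - z))\<bar> \<le> ennreal (max 0 (- ln (norm (w - z))) + \<bar>L\<bar>)"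
      by (rule ennreal_leI)
    then show ?thesis using True by (simp add: ennreal_plus)
  qed auto
  have bnd: "(\<integral>\<^sup>+z. ennreal (norm (?f z)) \<partial>lborel) \<le> ennreal (4 * pi + \<bar>L\<bar> * pi * R\<^sup>2)"
  proof -
    have "(\<integral>\<^sup>+z. ennreal (norm (?f z)) \<partial>lborel)
        \<le> (\<integral>\<^sup>+z. ennreal (max 0 (- ln (norm (w - z)))) + ennreal \<bar>L\<bar> * indicator (ball c R) z \<partial>lborel)"
      by (intro nn_integral_mono le)
    also have "\<dots> = (\<integral>\<^sup>+z. ennreal (max 0 (- ln (norm (w - z)))) \<partial>lborel) + ennreal \<bar>L\<bar> * ennreal (pi * R\<^sup>2)"
      using R by (subst nn_integral_add)
        (auto simp: nn_integral_cmult_indicator emeasure_ball_complex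
           intro!: borel_measurable_times_ennreal borel_measurable_indicator)
    also have "\<dots> \<le> ennreal (4 * pi) + ennreal \<bar>L\<bar> * ennreal (pi * R\<^sup>2)"
      by (intro add_right_mono nn_integral_neg_ln_norm_diff_le)
    also have "\<dots> = ennreal (4 * pi + \<bar>L\<bar> * pi * R\<^sup>2)"
      by (subst ennreal_mult'[symmetric], simp, subst ennreal_plus[symmetric]) (simp_all add: mult.assoc)
    finally show ?thesis .
  qed
  have int: "integrable lborel ?f"
  proof (rule integrableI_bounded)
    show "?f \<in> borel_measurable lborel"
      by (intro borel_measurable_scaleR borel_measurable_indicator) auto
    show "(\<integral>\<^sup>+z. ennreal (norm (?f z)) \<partial>lborel) < \<infinity>"
      using bnd by (rule le_less_trans) simp
  qed
  then show "set_integrable lborel (ball c R) (\<lambda>z. ln (norm (w - z)))"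
    by (simp add: set_integrable_def)
  have "(LINT z:ball c R|lborel. \<bar>ln (norm (w - z))\<bar>) = (LINT z|lborel. norm (?f z))"
    unfolding set_lebesgue_integral_def by (intro Bochner_Integration.integral_cong) (auto simp: indicator_def)
  also have "\<dots> = enn2real (\<integral>\<^sup>+z. ennreal (norm (?f z)) \<partial>lborel)"
    using borel_measurable_integrable[OF int] by (intro integral_eq_nn_integral) auto
  also have "\<dots> \<le> 4 * pi + \<bar>L\<bar> * pi * R\<^sup>2"
    by (rule enn2real_leI[OF _ bnd]) (use R in auto)
  finally show "(LINT z:ball c R|lborel. \<bar>ln (norm (w - z))\<bar>) \<le> 4 * pi + \<bar>L\<bar> * pi * R\<^sup>2" .
qed

section \<open>The logarithmic potential of a disc\<close>

lemma set_integral_ball_0: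
  fixes f :: "complex \<Rightarrow> real"
  assumes [measurable]: "f \<in> borel_measurable borel"
  shows "(LINT z:ball c R|lborel. f z) = (LINT z:ball 0 R|lborel. f (c + z))"
proof -
  have [measurable]: "ball c R \<in> sets borel" "ball 0 R \<in> sets borel" by auto
  have "(LINT z:ball c R|lborel. f z) = (LINT z:ball c R|distr lborel borel ((+) c). f z)"
    by (simp add: lborel_distr_plus)
  also have "\<dots> = (LINT z|lborel. indicator (ball c R) (c + z) *\<^sub>R f (c + z))"
    unfolding set_lebesgue_integral_def by (subst integral_distr) auto
  also have "\<dots> = (LINT z:ball 0 R|lborel. f (c + z))"
    unfolding set_lebesgue_integral_def
    by (rule Bochner_Integration.integral_cong) (auto simp: indicator_def dist_norm)
  finally show ?thesis .
qed

section \<open>Disc integrals through circle means\<close>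

text \<open>Rotating the integrand by any angle t leaves its integral over the disc unchanged.
  Averaging over t and exchanging the integrals replaces \<open>F\<close> by its circle means. The
  means are required only almost everywhere, because circles through a logarithmic singularity will
  be left out.\<close>

lemma set_integral_ball_circle_means:
  fixes F M :: "complex \<Rightarrow> real"
  assumes F: "set_integrable lborel (ball 0 R) F"
    and M [measurable]: "set_borel_measurable borel (ball 0 R) M"
    and mean: "AE \<zeta> in lborel. \<zeta> \<in> ball 0 R \<longrightarrow> ((\<lambda>t. F (cis t * \<zeta>)) has_integral 2 * pi * M \<zeta>) {0..2*pi}"
  shows "(LINT z:ball 0 R|lborel. F z) = (LINT z:ball 0 R|lborel. M z)"
proof -
  define F1 where "F1 = (\<lambda>z. indicator (ball 0 R) z *\<^sub>R F z)"
  have F1: "integrable lborel F1" using F by (simp add: F1_def set_integrable_def)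
  have [measurable]: "F1 \<in> borel_measurable borel"
    using borel_measurable_integrable[OF F1] by simp
  have cm [measurable]: "cis \<in> borel_measurable borel"
    by (intro borel_measurable_continuous_onI continuous_intros)
  define f where "f = (\<lambda>(t::real, \<zeta>). indicator {0..2*pi} t *\<^sub>R F1 (cis t * \<zeta>))"
  have fm: "f \<in> borel_measurable (lborel \<Otimes>\<^sub>M lborel)"
    unfolding f_def by measurable
  have rot: "integrable lborel (\<lambda>\<zeta>. F1 (cis t * \<zeta>))" "integrable lborel (\<lambda>\<zeta>. norm (F1 (cis t * \<zeta>)))"
    "(LINT \<zeta>|lborel. F1 (cis t * \<zeta>)) = integral\<^sup>L lborel F1"
    "(LINT \<zeta>|lborel. norm (F1 (cis t * \<zeta>))) = (LINT \<zeta>|lborel. norm (F1 \<zeta>))" for t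
    using F1 by (subst integrable_lborel_rotation_iff integral_lborel_rotation
        integral_lborel_rotation[of _ "\<lambda>z. norm (F1 z)"], auto)+
  have int: "integrable (lborel \<Otimes>\<^sub>M lborel) f"
  proof (rule lborel_pair.Fubini_integrable[OF fm])
    have "(\<lambda>t. LINT \<zeta>|lborel. norm (f (t, \<zeta>))) = (\<lambda>t. indicator {0..2*pi} t *\<^sub>R (LINT \<zeta>|lborel. norm (F1 \<zeta>)))"
      using rot(4) by (auto simp: f_def fun_eq_iff indicator_def)
    then show "integrable lborel (\<lambda>t. LINT \<zeta>|lborel. norm (f (t, \<zeta>)))"
      by simp
    show "AE t in lborel. integrable lborel (\<lambda>\<zeta>. f (t, \<zeta>))"
      using rot(1) by (auto simp: f_def)
  qed
  have int': "integrable (lborel \<Otimes>\<^sub>M lborel) (\<lambda>(t, \<zeta>). f (t, \<zeta>))" using int by simp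
  have "2 * pi * (LINT z:ball 0 R|lborel. F z) = (LINT t|lborel. (LINT \<zeta>|lborel. f (t, \<zeta>)))"
    by (simp add: f_def rot(3)) (simp add: F1_def set_lebesgue_integral_def)
  also have "\<dots> = (LINT \<zeta>|lborel. (LINT t|lborel. f (t, \<zeta>)))"
    by (rule lborel_pair.Fubini_integral[OF int', symmetric])
  also have "\<dots> = (LINT \<zeta>|lborel. 2 * pi * (indicator (ball 0 R) \<zeta> *\<^sub>R M \<zeta>))"
  proof (rule integral_cong_AE)
    show "(\<lambda>\<zeta>. LINT t|lborel. f (t, \<zeta>)) \<in> borel_measurable lborel"
      using lborel_pair.integrable_snd[OF int'] by (rule borel_measurable_integrable)
    show "(\<lambda>\<zeta>. 2 * pi * (indicator (ball 0 R) \<zeta> *\<^sub>R M \<zeta>)) \<in> borel_measurable lborel"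
      using M unfolding set_borel_measurable_def by simp
    show "AE \<zeta> in lborel. (LINT t|lborel. f (t, \<zeta>)) = 2 * pi * (indicator (ball 0 R) \<zeta> *\<^sub>R M \<zeta>)"
      using mean lborel_pair.AE_integrable_snd[OF int']
    proof eventually_elim
      case (elim \<zeta>)
      show ?case
      proof (cases "\<zeta> \<in> ball 0 R")
        case True
        then have eq: "f (t, \<zeta>) = indicator {0..2*pi} t *\<^sub>R F (cis t * \<zeta>)" for t
          by (simp add: f_def F1_def norm_mult)
        \<comment> \<open>\<open>mean\<close> is a gauge integral; Fubini supplies, for almost every
          zeta, the Lebesgue integrability in t that identifies it with the Lebesgue
          integral.\<close>
        have "set_integrable lborel {0..2*pi} (\<lambda>t. F (cis t * \<zeta>))"
          using elim(2) by (simp add: set_integrable_def eq)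
        from set_borel_integral_eq_integral(2)[OF this]
        have "(LINT t|lborel. f (t, \<zeta>)) = integral {0..2*pi} (\<lambda>t. F (cis t * \<zeta>))"
          by (simp add: eq set_lebesgue_integral_def)
        then show ?thesis using elim(1) True by (simp add: integral_unique)
      qed (simp add: f_def F1_def norm_mult)
    qed
  qed
  also have "\<dots> = 2 * pi * (LINT z:ball 0 R|lborel. M z)"
    by (simp add: set_lebesgue_integral_def)
  finally show ?thesis by simp
qed

text \<open>Cauchy's formula at the origin for the dilated function u -> f(u zeta) on the unit
  circle. The dilation also covers zeta = 0 without a separate case.\<close>

lemma holomorphic_circle_mean:
  fixes f :: "complex \<Rightarrow> complex"
  assumes f: "f holomorphic_on ball 0 R" and \<zeta>: "norm \<zeta> < R"
  shows "((\<lambda>t. f (cis t * \<zeta>)) has_integral 2 * pi * f 0) {0..2*pi}"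
proof -
  have sub: "(\<lambda>u. u * \<zeta>) ` cball 0 1 \<subseteq> ball 0 R"
  proof safe
    fix u :: complex assume "u \<in> cball 0 1"
    then show "u * \<zeta> \<in> ball 0 R"
      using \<zeta> mult_right_mono[of "norm u" 1 "norm \<zeta>"] by (simp add: norm_mult)
  qed
  have hol: "(\<lambda>u. f (u * \<zeta>)) holomorphic_on cball 0 1"
    by (rule holomorphic_on_compose_gen[OF _ f sub, unfolded comp_def]) (intro holomorphic_intros)
  have "((\<lambda>u. f (u * \<zeta>) / (u - 0)) has_contour_integral (2 * of_real pi * \<i> * f (0 * \<zeta>))) (circlepath 0 1)"
    by (rule Cauchy_integral_circlepath)
       (auto intro: holomorphic_on_imp_continuous_on[OF hol] holomorphic_on_subset[OF hol])
  then have "((\<lambda>t. f (cis t * \<zeta>) * \<i>) has_integral 2 * of_real pi * \<i> * f 0) {0..2*pi}"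
    unfolding circlepath_def by (subst (asm) has_contour_integral_part_circlepath_iff) simp_all
  from has_integral_mult_right[OF this, of "- \<i>"] show ?thesis by (simp add: algebra_simps)
qed

lemma Re_holomorphic_circle_mean:
  fixes f :: "complex \<Rightarrow> complex"
  assumes f: "f holomorphic_on ball 0 R" and \<zeta>: "norm \<zeta> < R"
  shows "((\<lambda>t. Re (f (cis t * \<zeta>))) has_integral 2 * pi * Re (f 0)) {0..2*pi}"
  using has_integral_linear[OF holomorphic_circle_mean[OF assms] bounded_linear_Re] by (simp add: o_def)

text \<open>For |u| < |w| the number 1 - u/w has positive real part, so the principal
  \<open>Ln\<close> makes log|w - u| the real part of a function holomorphic in that disc.\<close>

lemma ln_norm_circle_mean_less:
  assumes "norm \<zeta> < norm w"
  shows "((\<lambda>t. ln (norm (w - cis t * \<zeta>))) has_integral 2 * pi * ln (norm w)) {0..2*pi}"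
proof -
  have w: "w \<noteq> 0" using assms by auto
  have pos: "0 < Re (1 - u / w)" if "norm u < norm w" for u
  proof -
    have "norm (u / w) < 1" using that w by (simp add: norm_divide)
    then show ?thesis using complex_Re_le_cmod[of "u / w"] by simp
  qed
  have hol: "(\<lambda>u. Ln (1 - u / w) + ln (norm w)) holomorphic_on ball 0 (norm w)"
    using w pos by (intro holomorphic_intros) (auto simp: complex_nonpos_Reals_iff simp del: minus_complex.sel dest: leD)
  have eq: "Re (Ln (1 - u / w) + ln (norm w)) = ln (norm (w - u))" if "norm u < norm w" for u
  proof -
    have nz: "1 - u / w \<noteq> 0" using pos[OF that] by auto
    have "w * (1 - u / w) = w - u" using w by (simp add: field_simps)
    then have "norm (w - u) = norm w * norm (1 - u / w)"
      by (metis norm_mult)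
    then show ?thesis using nz w by (simp add: ln_mult)
  qed
  have "((\<lambda>t. Re (Ln (1 - cis t * \<zeta> / w) + ln (norm w))) has_integral 2 * pi * Re (Ln (1 - 0 / w) + ln (norm w))) {0..2*pi}"
    by (rule Re_holomorphic_circle_mean[OF hol assms])
  then show ?thesis using eq[of "cis _ * \<zeta>"] assms by (simp add: norm_mult)
qed

text \<open>If |zeta| > |w|, the identity |w - e^(it) zeta| = |cnj zeta - e^(it) cnj w| exchanges
  the two roles. The excluded equality describes a circle of \<open>\<zeta>\<close>, a null set for
  the area integral.\<close>

lemma ln_norm_circle_mean:
  assumes "norm \<zeta> \<noteq> norm w"
  shows "((\<lambda>t. ln (norm (w - cis t * \<zeta>))) has_integral 2 * pi * ln (max (norm w) (norm \<zeta>))) {0..2*pi}"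
proof (cases "norm \<zeta> < norm w")
  case True
  then show ?thesis using ln_norm_circle_mean_less by (simp add: max_def)
next
  case False
  then have "norm (cnj w) < norm (cnj \<zeta>)" using assms by simp
  from ln_norm_circle_mean_less[OF this]
  have "((\<lambda>t. ln (norm (cnj \<zeta> - cis t * cnj w))) has_integral 2 * pi * ln (norm \<zeta>)) {0..2*pi}" by simp
  moreover have "norm (cnj \<zeta> - cis t * cnj w) = norm (w - cis t * \<zeta>)" for t
  proof -
    have "norm (cnj \<zeta> - cis t * cnj w) = norm (cnj (cnj \<zeta> - cis t * cnj w))" by (simp only: complex_mod_cnj)
    also have "\<dots> = norm (cis t * (\<zeta> - cis (- t) * w))"
      by (simp add: norm_mult cis_cnj)
    also have "cis t * (\<zeta> - cis (- t) * w) = - (w - cis t * \<zeta>)"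
      by (simp add: algebra_simps cis_mult flip: mult.assoc)
    finally show ?thesis by (simp only: norm_minus_cancel)
  qed
  ultimately show ?thesis using False by (simp add: max_def)
qed

text \<open>Junk value: division by zero makes \<open>disc_potential R 0 = 0\<close>.\<close>

definition disc_potential :: "real \<Rightarrow> real \<Rightarrow> real" where
  "disc_potential R s = (LINT \<zeta>:ball (0::complex) R|lborel. ln (max 1 (norm \<zeta> / s)))"

lemma set_integrable_const_ball [simp]:
  fixes k :: real and c :: complex
  shows "set_integrable lborel (ball c R) (\<lambda>_. k)"
proof -
  have "integrable lborel (indicator (ball c R) :: complex \<Rightarrow> real)"
    using emeasure_bounded_finite[OF bounded_ball[of c R]]
    by (intro integrable_real_indicator) auto
  then show ?thesis by (simp add: set_integrable_def)
qed

lemma set_integrable_ln_max: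
  assumes "s \<ge> 0"
  shows "set_integrable lborel (ball (0::complex) R) (\<lambda>\<zeta>. ln (max 1 (norm \<zeta> / s)))"
proof (rule set_integrable_subset)
  have "continuous_on (cball (0::complex) R) (\<lambda>\<zeta>. ln (max 1 (norm \<zeta> / s)))"
    using assms by (cases "s = 0") (auto intro!: continuous_intros)
  then show "set_integrable lborel (cball (0::complex) R) (\<lambda>\<zeta>. ln (max 1 (norm \<zeta> / s)))"
    unfolding set_integrable_def by (intro borel_integrable_compact) auto
qed auto

text \<open>By the circle means, log|w - c - zeta| may be replaced under the integral by log max(|w
  - c|, |zeta|), which is log|w - c| plus the integrand of \<open>disc_potential\<close>. This is
  the mean value property with its exact defect.\<close>

lemma set_integral_ln_norm_diff:
  fixes w c :: complex
  assumes R: "R \<ge> 0" and w: "w \<noteq> c"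
  shows "(LINT \<zeta>:ball c R|lborel. ln (norm (w - \<zeta>))) = pi * R\<^sup>2 * ln (norm (w - c)) + disc_potential R (norm (w - c))"
proof -
  let ?w = "w - c"
  have "(LINT \<zeta>:ball c R|lborel. ln (norm (w - \<zeta>))) = (LINT \<zeta>:ball 0 R|lborel. ln (norm (?w - \<zeta>)))"
    by (subst set_integral_ball_0) (auto simp: algebra_simps)
  also have "\<dots> = (LINT \<zeta>:ball (0::complex) R|lborel. ln (max (norm ?w) (norm \<zeta>)))"
  proof (rule set_integral_ball_circle_means)
    show "set_integrable lborel (ball 0 R) (\<lambda>\<zeta>. ln (norm (?w - \<zeta>)))"
      by (rule set_integrable_ln_norm_diff[OF R, of _ _ "norm ?w + R"])
         (auto intro: order_trans[OF norm_triangle_ineq4])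
    show "set_borel_measurable borel (ball 0 R) (\<lambda>\<zeta>::complex. ln (max (norm ?w) (norm \<zeta>)))"
      unfolding set_borel_measurable_def by (intro borel_measurable_scaleR borel_measurable_indicator) auto
    have "negligible (sphere (0::complex) (norm ?w))" by (rule negligible_sphere)
    then have "sphere (0::complex) (norm ?w) \<in> null_sets lborel"
      by (simp add: negligible_iff_null_sets null_sets_completion_iff)
    then have "AE \<zeta> in lborel. \<zeta> \<notin> sphere (0::complex) (norm ?w)" by (rule AE_not_in)
    then show "AE \<zeta> in lborel. \<zeta> \<in> ball 0 R \<longrightarrow>
      ((\<lambda>t. ln (norm (?w - cis t * \<zeta>))) has_integral 2 * pi * ln (max (norm ?w) (norm \<zeta>))) {0..2*pi}"
      by eventually_elim (auto intro!: ln_norm_circle_mean)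
  qed
  also have "\<dots> = (LINT \<zeta>:ball (0::complex) R|lborel. ln (norm ?w) + ln (max 1 (norm \<zeta> / norm ?w)))"
  proof (rule set_lebesgue_integral_cong)
    show "\<forall>\<zeta>::complex. \<zeta> \<in> ball 0 R \<longrightarrow> ln (max (norm ?w) (norm \<zeta>)) = ln (norm ?w) + ln (max 1 (norm \<zeta> / norm ?w))"
    proof (intro allI impI)
      fix \<zeta> :: complex
      have "max (norm ?w) (norm \<zeta>) = norm ?w * max 1 (norm \<zeta> / norm ?w)"
        using w by (subst max_mult_distrib_left) auto
      then show "ln (max (norm ?w) (norm \<zeta>)) = ln (norm ?w) + ln (max 1 (norm \<zeta> / norm ?w))"
        using w by (simp add: ln_mult)
    qed
  qed auto
  also have "\<dots> = (LINT \<zeta>:ball (0::complex) R|lborel. ln (norm ?w)) + disc_potential R (norm ?w)"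
    unfolding disc_potential_def
    by (intro set_integral_add set_integrable_ln_max set_integrable_const_ball norm_ge_zero)
  also have "(LINT \<zeta>:ball (0::complex) R|lborel. ln (norm ?w)) = pi * R\<^sup>2 * ln (norm ?w)"
    using R by (simp add: set_lebesgue_integral_def measure_ball_complex)
  finally show ?thesis .
qed

section \<open>Jensen's formula over discs\<close>

lemma integrable_indicator_ball [simp]:
  "integrable lborel (indicator (ball (c::complex) R) :: _ \<Rightarrow> real)"
  using set_integrable_const_ball[of c R 1] by (simp add: set_integrable_def)

lemma integral_indicator_diff_ball:
  assumes "0 \<le> s" "s \<le> R"
  shows "(LINT \<zeta>|lborel. k * indicator (ball (0::complex) R) \<zeta> - k * indicator (ball 0 s) \<zeta>) = pi * (R\<^sup>2 - s\<^sup>2) * (k::real)"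
  using assms by (subst Bochner_Integration.integral_diff)
    (simp_all add: measure_ball_complex algebra_simps)

lemma disc_potential_nonneg: "disc_potential R s \<ge> 0"
  unfolding disc_potential_def set_lebesgue_integral_def
  by (intro Bochner_Integration.integral_nonneg) (auto simp: indicator_def)

lemma disc_potential_eq_0:
  assumes "0 < s" "R \<le> s"
  shows "disc_potential R s = 0"
proof -
  have "disc_potential R s = (LINT \<zeta>:ball (0::complex) R|lborel. 0)"
    unfolding disc_potential_def using assms
    by (intro set_lebesgue_integral_cong) (auto simp: max_def)
  then show ?thesis by simp
qed

text \<open>The integrand vanishes for |zeta| < s and is at most ln(R/s) on the remaining
  annulus.\<close>

lemma disc_potential_le:
  assumes "0 < s" "s \<le> R"
  shows "disc_potential R s \<le> pi * (R\<^sup>2 - s\<^sup>2) * ln (R / s)"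
proof -
  have "disc_potential R s \<le> (LINT \<zeta>|lborel. ln (R / s) * indicator (ball (0::complex) R) \<zeta> - ln (R / s) * indicator (ball 0 s) \<zeta>)"
    unfolding disc_potential_def set_lebesgue_integral_def
  proof (rule integral_mono)
    show "integrable lborel (\<lambda>\<zeta>::complex. indicator (ball 0 R) \<zeta> *\<^sub>R ln (max 1 (norm \<zeta> / s)))"
      using set_integrable_ln_max[of s R] assms by (simp add: set_integrable_def)
    show "indicator (ball 0 R) \<zeta> *\<^sub>R ln (max 1 (norm \<zeta> / s))
        \<le> ln (R / s) * indicator (ball (0::complex) R) \<zeta> - ln (R / s) * indicator (ball 0 s) \<zeta>" for \<zeta> :: complex
      using assms by (auto simp: indicator_def max_def divide_simps intro!: ln_mono divide_right_mono)
  qed (intro Bochner_Integration.integrable_diff integrable_mult_right integrable_indicator_ball)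
  then show ?thesis using assms by (subst (asm) integral_indicator_diff_ball) auto
qed

text \<open>Only the annulus from \<open>q\<close> to \<open>R\<close> is kept, where the integrand
  is at least ln(q/s). The radius \<open>q\<close> stays free, to be adapted to each
  application.\<close>

lemma disc_potential_ge:
  assumes "0 < s" "s \<le> q" "q \<le> R"
  shows "pi * (R\<^sup>2 - q\<^sup>2) * ln (q / s) \<le> disc_potential R s"
proof -
  have "(LINT \<zeta>|lborel. ln (q / s) * indicator (ball (0::complex) R) \<zeta> - ln (q / s) * indicator (ball 0 q) \<zeta>) \<le> disc_potential R s"
    unfolding disc_potential_def set_lebesgue_integral_def
  proof (rule integral_mono)
    show "integrable lborel (\<lambda>\<zeta>::complex. indicator (ball 0 R) \<zeta> *\<^sub>R ln (max 1 (norm \<zeta> / s)))"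
      using set_integrable_ln_max[of s R] assms by (simp add: set_integrable_def)
    show "ln (q / s) * indicator (ball (0::complex) R) \<zeta> - ln (q / s) * indicator (ball 0 q) \<zeta>
       \<le> indicator (ball 0 R) \<zeta> *\<^sub>R ln (max 1 (norm \<zeta> / s))" for \<zeta> :: complex
      using assms by (auto simp: indicator_def max_def divide_simps intro!: ln_mono divide_right_mono)
  qed (intro Bochner_Integration.integrable_diff integrable_mult_right integrable_indicator_ball)
  then show ?thesis using assms by (subst (asm) integral_indicator_diff_ball) auto
qed

lemma measurable_disc_potential [measurable]: "disc_potential R \<in> borel_measurable borel"
proof -
  have [measurable]: "ball (0::complex) R \<in> sets borel" by auto
  show ?thesis
    unfolding disc_potential_def set_lebesgue_integral_def
    by (intro lborel.borel_measurable_lebesgue_integral)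
       (subst measurable_cong_sets[OF sets_pair_measure_cong[OF refl sets_lborel] refl], measurable)
qed

text \<open>On a disc without zeros \<open>h\<close> has a holomorphic logarithm, whose real part
  log|h| satisfies the mean value property on every circle.\<close>

lemma area_mean_ln_norm_nonvanishing:
  assumes h: "h holomorphic_on ball 0 R" and nz: "\<And>z. z \<in> ball 0 R \<Longrightarrow> h z \<noteq> 0"
    and r: "0 < r" "r < R"
  shows "set_integrable lborel (ball 0 r) (\<lambda>z. ln (norm (h z)))" (is ?int)
    and "(LINT z:ball 0 r|lborel. ln (norm (h z))) = pi * r\<^sup>2 * ln (norm (h 0))"
proof -
  obtain g where g: "g holomorphic_on ball 0 R" "\<And>z. z \<in> ball 0 R \<Longrightarrow> exp (g z) = h z"
    using holomorphic_logarithm_exists[OF convex_ball open_ball h nz, of 0] r by auto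
  have eq: "ln (norm (h z)) = Re (g z)" if "z \<in> ball 0 R" for z
    by (simp flip: g(2)[OF that])
  have cont: "continuous_on (cball 0 r) (\<lambda>z. ln (norm (h z)))"
    using r nz by (intro continuous_intros holomorphic_on_imp_continuous_on holomorphic_on_subset[OF h]) auto
  have "set_integrable lborel (cball 0 r) (\<lambda>z. ln (norm (h z)))"
    unfolding set_integrable_def using cont by (intro borel_integrable_compact) auto
  then show ?int by (rule set_integrable_subset) auto
  then have "(LINT z:ball 0 r|lborel. ln (norm (h z))) = (LINT z:ball (0::complex) r|lborel. ln (norm (h 0)))"
  proof (rule set_integral_ball_circle_means)
    show "set_borel_measurable borel (ball (0::complex) r) (\<lambda>_. ln (norm (h 0)))"
      unfolding set_borel_measurable_def by (intro borel_measurable_scaleR borel_measurable_indicator) auto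
    show "AE \<zeta> in lborel. \<zeta> \<in> ball 0 r \<longrightarrow>
        ((\<lambda>t. ln (norm (h (cis t * \<zeta>)))) has_integral 2 * pi * ln (norm (h 0))) {0..2*pi}"
    proof (intro always_eventually allI impI)
      fix \<zeta> :: complex assume "\<zeta> \<in> ball 0 r"
      then have \<zeta>: "norm \<zeta> < R" using r by auto
      show "((\<lambda>t. ln (norm (h (cis t * \<zeta>)))) has_integral 2 * pi * ln (norm (h 0))) {0..2*pi}"
        using Re_holomorphic_circle_mean[OF g(1) \<zeta>] eq[of 0] eq[of "cis _ * \<zeta>"] \<zeta> r by (simp add: norm_mult)
    qed
  qed
  also have "\<dots> = pi * r\<^sup>2 * ln (norm (h 0))"
    using r by (simp add: set_lebesgue_integral_def measure_ball_complex)
  finally show "(LINT z:ball 0 r|lborel. ln (norm (h z))) = pi * r\<^sup>2 * ln (norm (h 0))" .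
qed

lemma zorder_linear_power: "zorder (\<lambda>z. (z - b) ^ k) b = int k" for b :: complex
  by (rule zorder_eqI[where S = UNIV and g = "\<lambda>_. 1"]) auto

lemma finite_zeros_ball:
  assumes g: "g holomorphic_on ball 0 1" and g0: "g 0 \<noteq> 0" and r: "r < 1"
  shows "finite {a \<in> ball 0 r. g a = 0}"
proof (cases "g constant_on ball 0 1")
  case True
  then obtain k where k: "g a = k" if "a \<in> ball 0 1" for a by (auto simp: constant_on_def)
  have "g a \<noteq> 0" if "a \<in> ball 0 r" for a
    using k[of a] k[of 0] g0 that r by simp
  then have "{a \<in> ball 0 r. g a = 0} = {}" by blast
  then show ?thesis by (simp only: finite.emptyI)
next
  case False
  have "finite {z \<in> cball 0 r. g z = 0}"
    by (rule holomorphic_compact_finite_zeros[OF g _ _ _ _ False]) (use r in auto)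
  then show ?thesis by (rule rev_finite_subset) auto
qed

text \<open>\<open>zorder\<close> is informative only if \<open>g\<close> is not identically zero
  near \<open>a\<close>; by connectedness of the disc, \<open>g 0 \<noteq> 0\<close> rules that
  out.\<close>

lemma zorder_pos_of_zero:
  assumes g: "g holomorphic_on ball 0 1" and g0: "g 0 \<noteq> 0" and a: "a \<in> ball 0 1" "g a = 0"
  shows "zorder g a > 0"
proof -
  have "eventually (\<lambda>z. g z \<noteq> 0 \<and> z \<in> ball 0 1) (at a)"
    by (rule non_zero_neighbour_alt[OF g open_ball connected_ball a(1) _ g0]) auto
  then have "frequently (\<lambda>z. g z \<noteq> 0) (at a)"
    by (intro eventually_frequently) (auto elim: eventually_mono)
  then show ?thesis using zorder_pos_iff[OF g open_ball a(1)] a(2) by simp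
qed

text \<open>The product of linear factors over the finitely many zeros has the same order as
  \<open>g\<close> at every point of the disc, so the two functions differ by a holomorphic factor
  without zeros.\<close>

lemma zero_factorization:
  assumes g: "g holomorphic_on ball 0 1" and g0: "g 0 \<noteq> 0" and r: "0 < r" "r < 1"
  defines "Z \<equiv> {a \<in> ball 0 r. g a = 0}"
  obtains h where "h holomorphic_on ball 0 r" "\<And>z. z \<in> ball 0 r \<Longrightarrow> h z \<noteq> 0"
    "\<And>z. z \<in> ball 0 r \<Longrightarrow> g z = h z * (\<Prod>a\<in>Z. (z - a) ^ nat (zorder g a))"
proof -
  have fin: "finite Z" unfolding Z_def by (rule finite_zeros_ball[OF g g0 r(2)])
  have g': "g holomorphic_on ball 0 r" using g r by (rule_tac holomorphic_on_subset) auto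
  define f where "f = (\<lambda>z. \<Prod>a\<in>Z. (z - a) ^ nat (zorder g a))"
  have pos: "zorder g a > 0" if "a \<in> Z" for a
    using zorder_pos_of_zero[OF g g0, of a] that r by (auto simp: Z_def)
  have f0: "f z = 0 \<longleftrightarrow> z \<in> Z" for z
    using fin pos by (auto simp: f_def prod_zero_iff)
  have hol: "f holomorphic_on A" for A unfolding f_def by (intro holomorphic_intros)
  have an: "f analytic_on A" for A unfolding f_def by (intro analytic_intros)
  have zo: "zorder f z = zorder g z" if z: "z \<in> ball 0 r" for z
  proof (cases "z \<in> Z")
    case False
    have "g analytic_on {z}" using g' z by (metis analytic_at open_ball)
    then show ?thesis using False z f0 an
      by (subst (1 2) zorder_eq_0I) (auto simp: Z_def)
  next
    case True
    \<comment> \<open>Near \<open>z\<close> the other zeros are avoided, so the product does not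
      vanish in a punctured neighbourhood; this is what permits adding the orders of its
      factors.\<close>
    have "open (- (Z - {z}))" using fin by (intro open_Compl finite_imp_closed) auto
    then have "eventually (\<lambda>w. w \<in> -(Z - {z})) (at z)"
      by (rule eventually_at_in_open') auto
    moreover have "eventually (\<lambda>w. w \<noteq> z) (at z)" by (rule eventually_neq_at_within)
    ultimately have "eventually (\<lambda>w. f w \<noteq> 0) (at z)"
      by eventually_elim (use f0 in auto)
    then have "zorder f z = (\<Sum>a\<in>Z. zorder (\<lambda>z. (z - a) ^ nat (zorder g a)) z)"
      unfolding f_def by (intro zorder_prod_analytic analytic_intros)
    also have "\<dots> = (\<Sum>a\<in>Z. if a = z then zorder g z else 0)"
    proof (rule sum.cong)
      fix a assume "a \<in> Z"
      show "zorder (\<lambda>z. (z - a) ^ nat (zorder g a)) z = (if a = z then zorder g z else 0)"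
      proof (cases "a = z")
        case True
        then show ?thesis using pos[OF \<open>a \<in> Z\<close>] by (simp add: zorder_linear_power)
      next
        case False
        then show ?thesis by (subst zorder_eq_0I) (auto intro!: analytic_intros)
      qed
    qed simp
    also have "\<dots> = zorder g z" using True fin by simp
    finally show ?thesis .
  qed
  have "\<And>z. z \<in> ball 0 r \<Longrightarrow> f z = 0 \<longleftrightarrow> g z = 0" using f0 by (auto simp: Z_def)
  from holomorphic_zorder_factorization[OF g' open_ball connected_ball hol this zo]
  show ?thesis using that unfolding f_def by blast
qed

text \<open>Splitting off the zeros leaves a factor with the exact mean value property, while each
  linear factor contributes its defect \<open>disc_potential\<close>.\<close>

lemma area_Jensen:
  assumes g: "g holomorphic_on ball 0 1" and g0: "g 0 \<noteq> 0" and r: "0 < r" "r < 1"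
  shows "set_integrable lborel (ball 0 r) (\<lambda>z. ln (norm (g z)))"
    and "(LINT z:ball 0 r|lborel. ln (norm (g z))) = pi * r\<^sup>2 * ln (norm (g 0))
      + (\<Sum>a | a \<in> ball 0 r \<and> g a = 0. of_int (zorder g a) * disc_potential r (norm a))"
proof -
  \<comment> \<open>The factorization is made on a slightly larger disc, since the mean value
    property for \<open>h\<close> asks for holomorphy beyond radius \<open>r\<close>.\<close>
  define r' where "r' = (1 + r) / 2"
  have r': "0 < r'" "r' < 1" "r < r'" using r by (auto simp: r'_def)
  define Z where "Z = {a \<in> ball 0 r'. g a = 0}"
  have fin: "finite Z" unfolding Z_def by (rule finite_zeros_ball[OF g g0 r'(2)])
  obtain h where h: "h holomorphic_on ball 0 r'" "\<And>z. z \<in> ball 0 r' \<Longrightarrow> h z \<noteq> 0"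
    "\<And>z. z \<in> ball 0 r' \<Longrightarrow> g z = h z * (\<Prod>a\<in>Z. (z - a) ^ nat (zorder g a))"
    using zero_factorization[OF g g0 r'(1,2)] unfolding Z_def by blast
  define k where "k = (\<lambda>a. real_of_int (zorder g a))"
  have pos: "zorder g a > 0" if "a \<in> Z" for a
    using zorder_pos_of_zero[OF g g0, of a] that r' by (auto simp: Z_def)
  have a0: "a \<noteq> 0" if "a \<in> Z" for a using that g0 by (auto simp: Z_def)
  \<comment> \<open>At a zero the convention \<open>ln 0 = 0\<close> spoils the identity, hence
    \<open>z \<notin> Z\<close>; this exception is finite and therefore null.\<close>
  have eq: "ln (norm (g z)) = ln (norm (h z)) + (\<Sum>a\<in>Z. k a * ln (norm (a - z)))"
    if z: "z \<in> ball 0 r'" "z \<notin> Z" for z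
  proof -
    have nz: "norm (a - z) ^ nat (zorder g a) > 0" if "a \<in> Z" for a
      using z(2) that by (intro zero_less_power) auto
    have "norm (g z) = norm (h z) * (\<Prod>a\<in>Z. norm (a - z) ^ nat (zorder g a))"
      by (simp add: h(3)[OF z(1)] norm_mult norm_power norm_minus_commute flip: prod_norm)
    also have "ln \<dots> = ln (norm (h z)) + (\<Sum>a\<in>Z. ln (norm (a - z) ^ nat (zorder g a)))"
      using h(2)[OF z(1)] nz z(2) fin by (subst ln_mult_pos) (auto intro!: prod_pos ln_prod nz)
    also have "(\<Sum>a\<in>Z. ln (norm (a - z) ^ nat (zorder g a))) = (\<Sum>a\<in>Z. k a * ln (norm (a - z)))"
      using z(2) pos by (intro sum.cong) (auto simp: ln_realpow k_def less_imp_le)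
    finally show ?thesis .
  qed
  have int_h: "set_integrable lborel (ball 0 r) (\<lambda>z. ln (norm (h z)))"
    and mean_h: "(LINT z:ball 0 r|lborel. ln (norm (h z))) = pi * r\<^sup>2 * ln (norm (h 0))"
    using area_mean_ln_norm_nonvanishing[OF h(1,2) r(1) r'(3)] by blast+
  have int_a: "set_integrable lborel (ball 0 r) (\<lambda>z. k a * ln (norm (a - z)))" for a :: complex
    using r by (intro set_integrable_mult_right set_integrable_ln_norm_diff[of _ _ _ "norm a + r"])
      (auto intro: order_trans[OF norm_triangle_ineq4])
  have int_sum: "set_integrable lborel (ball 0 r) (\<lambda>z. \<Sum>a\<in>Z. k a * ln (norm (a - z)))"
    using int_a unfolding set_integrable_def scaleR_sum_right by (intro Bochner_Integration.integrable_sum)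
  have int: "set_integrable lborel (ball 0 r) (\<lambda>z. ln (norm (h z)) + (\<Sum>a\<in>Z. k a * ln (norm (a - z))))"
    by (intro set_integral_add int_h int_sum)
  have "Z \<in> null_sets lborel" using fin by (intro finite_imp_null_set_lborel)
  then have "AE z in lborel. z \<notin> Z" by (rule AE_not_in)
  then have AE: "AE z in lborel. z \<in> ball 0 r \<longrightarrow>
     ln (norm (g z)) = ln (norm (h z)) + (\<Sum>a\<in>Z. k a * ln (norm (a - z)))"
    by eventually_elim (use eq r' in auto)
  have "continuous_on (ball 0 r) g"
    by (intro holomorphic_on_imp_continuous_on holomorphic_on_subset[OF g]) (use r in auto)
  then have "(\<lambda>z. indicator (ball 0 r) z *\<^sub>R g z) \<in> borel_measurable borel"
    by (intro borel_measurable_continuous_on_indicator) auto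
  \<comment> \<open>The indicator can be moved out of the logarithm because
    \<open>ln (norm 0) = 0\<close>.\<close>
  then have "(\<lambda>z. ln (norm (indicator (ball 0 r) z *\<^sub>R g z))) \<in> borel_measurable borel"
    by measurable
  also have "(\<lambda>z. ln (norm (indicator (ball 0 r) z *\<^sub>R g z))) = (\<lambda>z. indicator (ball 0 r) z *\<^sub>R ln (norm (g z)))"
    by (auto simp: indicator_def)
  finally have meas: "set_borel_measurable lborel (ball 0 r) (\<lambda>z. ln (norm (g z)))"
    by (simp add: set_borel_measurable_def)
  show "set_integrable lborel (ball 0 r) (\<lambda>z. ln (norm (g z)))"
    unfolding set_integrable_def
  proof (rule integrable_cong_AE_imp[OF int[unfolded set_integrable_def]])
    show "(\<lambda>z. indicator (ball 0 r) z *\<^sub>R ln (norm (g z))) \<in> borel_measurable lborel"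
      using meas by (simp add: set_borel_measurable_def)
    show "AE z in lborel. indicator (ball 0 r) z *\<^sub>R (ln (norm (h z)) + (\<Sum>a\<in>Z. k a * ln (norm (a - z))))
      = indicator (ball 0 r) z *\<^sub>R ln (norm (g z))"
      using AE by eventually_elim (auto simp: indicator_def)
  qed
  have "(LINT z:ball 0 r|lborel. ln (norm (g z)))
      = (LINT z:ball 0 r|lborel. ln (norm (h z)) + (\<Sum>a\<in>Z. k a * ln (norm (a - z))))"
    unfolding set_lebesgue_integral_def
  proof (rule integral_cong_AE)
    show "(\<lambda>z. indicator (ball 0 r) z *\<^sub>R ln (norm (g z))) \<in> borel_measurable lborel"
      using meas by (simp add: set_borel_measurable_def)
    show "(\<lambda>z. indicator (ball 0 r) z *\<^sub>R (ln (norm (h z)) + (\<Sum>a\<in>Z. k a * ln (norm (a - z))))) \<in> borel_measurable lborel"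
      using int unfolding set_integrable_def by (rule borel_measurable_integrable)
    show "AE z in lborel. indicator (ball 0 r) z *\<^sub>R ln (norm (g z))
      = indicator (ball 0 r) z *\<^sub>R (ln (norm (h z)) + (\<Sum>a\<in>Z. k a * ln (norm (a - z))))"
      using AE by eventually_elim (auto simp: indicator_def)
  qed
  also have "\<dots> = (LINT z:ball 0 r|lborel. ln (norm (h z))) + (LINT z:ball 0 r|lborel. \<Sum>a\<in>Z. k a * ln (norm (a - z)))"
    by (intro set_integral_add int_h int_sum)
  also have "(LINT z:ball 0 r|lborel. \<Sum>a\<in>Z. k a * ln (norm (a - z)))
      = (\<Sum>a\<in>Z. (LINT z:ball 0 r|lborel. k a * ln (norm (a - z))))"
    using int_a unfolding set_lebesgue_integral_def set_integrable_def scaleR_sum_right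
    by (intro Bochner_Integration.integral_sum)
  also have "\<dots> = (\<Sum>a\<in>Z. k a * (pi * r\<^sup>2 * ln (norm a) + disc_potential r (norm a)))"
  proof (intro sum.cong refl)
    fix a assume "a \<in> Z"
    then show "(LINT z:ball 0 r|lborel. k a * ln (norm (a - z))) = k a * (pi * r\<^sup>2 * ln (norm a) + disc_potential r (norm a))"
      using set_integral_ln_norm_diff[of r a 0] r a0 by simp
  qed
  also have "(LINT z:ball 0 r|lborel. ln (norm (h z))) + \<dots>
     = pi * r\<^sup>2 * (ln (norm (h 0)) + (\<Sum>a\<in>Z. k a * ln (norm (a - 0)))) + (\<Sum>a\<in>Z. k a * disc_potential r (norm a))"
    by (simp add: mean_h algebra_simps sum.distrib sum_distrib_left)
  \<comment> \<open>The terms left at the centre are the logarithm of the factorization at the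
    origin, which is not a zero of \<open>g\<close>.\<close>
  also have "ln (norm (h 0)) + (\<Sum>a\<in>Z. k a * ln (norm (a - 0))) = ln (norm (g 0))"
  proof -
    have "0 \<notin> Z" using a0 by blast
    then show ?thesis using eq[of 0] r' by simp
  qed
  \<comment> \<open>Zeros with r <= |a| < r' have zero potential and drop out.\<close>
  also have "(\<Sum>a\<in>Z. k a * disc_potential r (norm a)) = (\<Sum>a | a \<in> ball 0 r \<and> g a = 0. k a * disc_potential r (norm a))"
  proof (rule sum.mono_neutral_right[OF fin])
    show "{a. a \<in> ball 0 r \<and> g a = 0} \<subseteq> Z" using r' by (auto simp: Z_def)
    show "\<forall>a\<in>Z - {a. a \<in> ball 0 r \<and> g a = 0}. k a * disc_potential r (norm a) = 0"
    proof
      fix a assume a: "a \<in> Z - {a. a \<in> ball 0 r \<and> g a = 0}"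
      then have "0 < norm a" "r \<le> norm a" using a0[of a] by (auto simp: Z_def)
      then show "k a * disc_potential r (norm a) = 0" by (simp add: disc_potential_eq_0)
    qed
  qed
  finally show "(LINT z:ball 0 r|lborel. ln (norm (g z))) = pi * r\<^sup>2 * ln (norm (g 0))
      + (\<Sum>a | a \<in> ball 0 r \<and> g a = 0. of_int (zorder g a) * disc_potential r (norm a))"
    by (simp add: k_def)
qed

section \<open>The area counting function\<close>

text \<open>The function \<open>J\<close> of the header comment; its \<open>G\<close> is \<^const>\<open>disc_potential\<close>.\<close>

definition area_counting :: "(complex \<Rightarrow> complex) \<Rightarrow> real \<Rightarrow> complex \<Rightarrow> real" where
  "area_counting \<phi> r w = (LINT z:ball 0 r|lborel. ln (norm (\<phi> z - w))) - pi * r\<^sup>2 * ln (norm (\<phi> 0 - w))"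

lemma set_integrable_ln_norm_holomorphic:
  assumes "\<phi> holomorphic_on ball 0 1" "0 < r" "r < 1" "\<phi> 0 \<noteq> w"
  shows "set_integrable lborel (ball 0 r) (\<lambda>z. ln (norm (\<phi> z - w)))"
  using assms by (intro area_Jensen(1) holomorphic_intros) auto

lemma area_counting_eq:
  assumes "\<phi> holomorphic_on ball 0 1" "0 < r" "r < 1" "\<phi> 0 \<noteq> w"
  shows "area_counting \<phi> r w
    = (\<Sum>a | a \<in> ball 0 r \<and> \<phi> a = w. of_int (zorder (\<lambda>u. \<phi> u - w) a) * disc_potential r (norm a))"
proof -
  have "(\<lambda>u. \<phi> u - w) holomorphic_on ball 0 1" using assms by (intro holomorphic_intros)
  from area_Jensen(2)[OF this] show ?thesis using assms by (simp add: area_counting_def)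
qed

lemma finite_preimages_ball:
  assumes "\<phi> holomorphic_on ball 0 1" "r < 1" "\<phi> 0 \<noteq> w"
  shows "finite {a. a \<in> ball 0 r \<and> \<phi> a = w}"
proof -
  have "(\<lambda>u. \<phi> u - w) holomorphic_on ball 0 1" using assms by (intro holomorphic_intros)
  from finite_zeros_ball[OF this] show ?thesis using assms by simp
qed

lemma zorder_preimage_pos:
  assumes "\<phi> holomorphic_on ball 0 1" "\<phi> 0 \<noteq> w" "a \<in> ball 0 1" "\<phi> a = w"
  shows "zorder (\<lambda>u. \<phi> u - w) a > 0"
  using assms by (intro zorder_pos_of_zero holomorphic_intros) auto

lemma area_counting_nonneg:
  assumes "\<phi> holomorphic_on ball 0 1" "0 < r" "r < 1" "\<phi> 0 \<noteq> w"
  shows "area_counting \<phi> r w \<ge> 0"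
  unfolding area_counting_eq[OF assms]
proof (intro sum_nonneg mult_nonneg_nonneg disc_potential_nonneg)
  fix a assume "a \<in> {a. a \<in> ball 0 r \<and> \<phi> a = w}"
  then show "0 \<le> real_of_int (zorder (\<lambda>u. \<phi> u - w) a)"
    using zorder_preimage_pos[OF assms(1,4), of a] assms(3) by auto
qed

text \<open>For fixed z the mean value identity with defect is applied to log|phi(z) - zeta| over
  the disc about \<open>c\<close>, then integrated in z. The subtracted term log|phi(0) - zeta| has
  no defect, since phi(0) is at distance at least \<open>R\<close> from \<open>c\<close>. All three
  claims come from one integrable function on the product.\<close>

lemma
  assumes hol: "\<phi> holomorphic_on ball 0 1" and r: "0 < r" "r < 1"
    and R: "0 < R" "R \<le> norm (\<phi> 0 - c)"
  shows set_integrable_area_counting: "set_integrable lborel (ball c R) (area_counting \<phi> r)"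
    and set_integrable_disc_potential: "set_integrable lborel (ball 0 r) (\<lambda>z. disc_potential R (norm (\<phi> z - c)))"
    and set_integral_area_counting: "(LINT \<zeta>:ball c R|lborel. area_counting \<phi> r \<zeta>)
      = pi * R\<^sup>2 * area_counting \<phi> r c + (LINT z:ball 0 r|lborel. disc_potential R (norm (\<phi> z - c)))"
proof -
  have c: "\<phi> 0 \<noteq> c" using R by auto
  have "continuous_on (ball 0 r) \<phi>"
    by (intro holomorphic_on_imp_continuous_on holomorphic_on_subset[OF hol]) (use r in auto)
  then have [measurable]: "(\<lambda>z. indicator (ball 0 r) z *\<^sub>R \<phi> z) \<in> borel_measurable borel"
    by (intro borel_measurable_continuous_on_indicator) auto
  have [measurable]: "ball (0::complex) r \<in> sets borel" "ball c R \<in> sets borel" by auto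
  have "continuous_on (cball 0 r) \<phi>"
    by (intro holomorphic_on_imp_continuous_on holomorphic_on_subset[OF hol]) (use r in auto)
  then have "bounded (\<phi> ` cball 0 r)" by (intro compact_imp_bounded compact_continuous_image) auto
  then obtain B where B: "\<And>z. z \<in> cball 0 r \<Longrightarrow> norm (\<phi> z) \<le> B"
    unfolding bounded_iff by blast
  define L where "L = B + norm c + R"
  have L: "norm (\<phi> z - \<zeta>) \<le> L" if "z \<in> ball 0 r" "\<zeta> \<in> ball c R" for z \<zeta>
  proof -
    have "norm (\<phi> z - \<zeta>) \<le> norm (\<phi> z) + norm \<zeta>" by (rule norm_triangle_ineq4)
    moreover have "norm \<zeta> \<le> norm c + R"
      using that(2) norm_triangle_ineq2[of \<zeta> c] by (simp add: dist_norm norm_minus_commute)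
    ultimately show ?thesis using B[of z] that(1) by (simp add: L_def)
  qed
  \<comment> \<open>Inside the logarithm \<open>\<phi>\<close> is cut off by the indicator: nothing
    is known of \<open>\<phi>\<close> outside the unit disc, and joint measurability is needed on
    the whole product.\<close>
  define f where "f = (\<lambda>(z, \<zeta>). indicator (ball 0 r) z *\<^sub>R indicator (ball c R) \<zeta> *\<^sub>R
      ln (norm (indicator (ball 0 r) z *\<^sub>R \<phi> z - \<zeta>)))"
  have f: "f (z, \<zeta>) = indicator (ball 0 r) z *\<^sub>R indicator (ball c R) \<zeta> *\<^sub>R ln (norm (\<phi> z - \<zeta>))" for z \<zeta>
    by (simp add: f_def indicator_def)
  have fm [measurable]: "f \<in> borel_measurable (lborel \<Otimes>\<^sub>M lborel)"
    unfolding f_def by measurable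
  \<comment> \<open>The bound for the inner integral of |log| is uniform in z because
    \<open>\<phi>\<close> is bounded on the closed disc of radius \<open>r\<close>; this gives
    integrability on the product.\<close>
  define K where "K = 4 * pi + \<bar>L\<bar> * pi * R\<^sup>2"
  have inner: "(LINT \<zeta>|lborel. norm (f (z, \<zeta>))) \<le> K * indicator (ball 0 r) z" for z
  proof (cases "z \<in> ball 0 r")
    case True
    have "(LINT \<zeta>|lborel. norm (f (z, \<zeta>))) = (LINT \<zeta>:ball c R|lborel. \<bar>ln (norm (\<phi> z - \<zeta>))\<bar>)"
      unfolding set_lebesgue_integral_def using True
      by (intro Bochner_Integration.integral_cong) (auto simp: f indicator_def)
    also have "\<dots> \<le> K"
      unfolding K_def by (rule set_integral_abs_ln_norm_diff_le) (use R L True in auto)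
    finally show ?thesis using True by simp
  qed (simp add: f)
  have int: "integrable (lborel \<Otimes>\<^sub>M lborel) f"
  proof (rule lborel_pair.Fubini_integrable[OF fm])
    show "integrable lborel (\<lambda>z. LINT \<zeta>|lborel. norm (f (z, \<zeta>)))"
    proof (rule Bochner_Integration.integrable_bound)
      show "integrable lborel (\<lambda>z::complex. K * indicator (ball 0 r) z)" by simp
      show "(\<lambda>z. LINT \<zeta>|lborel. norm (f (z, \<zeta>))) \<in> borel_measurable lborel" by measurable
      show "AE z in lborel. norm (LINT \<zeta>|lborel. norm (f (z, \<zeta>))) \<le> norm (K * indicator (ball 0 r) z)"
        using inner by (intro always_eventually allI) (simp add: order_trans[OF _ abs_ge_self])
    qed
    show "AE z in lborel. integrable lborel (\<lambda>\<zeta>. f (z, \<zeta>))"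
    proof (intro always_eventually allI)
      fix z show "integrable lborel (\<lambda>\<zeta>. f (z, \<zeta>))"
      proof (cases "z \<in> ball 0 r")
        case True
        then show ?thesis
          using set_integrable_ln_norm_diff[of R c "\<phi> z" L] R L[OF True] by (simp add: f set_integrable_def)
      qed (simp add: f)
    qed
  qed
  have int': "integrable (lborel \<Otimes>\<^sub>M lborel) (\<lambda>(z, \<zeta>). f (z, \<zeta>))" using int by simp
  define A where "A = (\<lambda>\<zeta>. LINT z:ball 0 r|lborel. ln (norm (\<phi> z - \<zeta>)))"
  have A: "(LINT z|lborel. f (z, \<zeta>)) = indicator (ball c R) \<zeta> *\<^sub>R A \<zeta>" for \<zeta>
    by (cases "\<zeta> \<in> ball c R") (simp_all add: f A_def set_lebesgue_integral_def)
  have int_A: "set_integrable lborel (ball c R) A"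
    using lborel_pair.integrable_snd[OF int'] by (simp add: A set_integrable_def)
  have int_0: "set_integrable lborel (ball c R) (\<lambda>\<zeta>. ln (norm (\<phi> 0 - \<zeta>)))"
    by (rule set_integrable_ln_norm_diff[of _ _ _ L]) (use R L r in auto)
  have J: "area_counting \<phi> r = (\<lambda>\<zeta>. A \<zeta> - pi * r\<^sup>2 * ln (norm (\<phi> 0 - \<zeta>)))"
    by (simp add: area_counting_def A_def fun_eq_iff)
  show "set_integrable lborel (ball c R) (area_counting \<phi> r)"
    unfolding J by (intro set_integral_diff set_integrable_mult_right int_A int_0)
  define u where "u = (\<lambda>z. ln (norm (\<phi> z - c)))"
  have int_u: "set_integrable lborel (ball 0 r) u"
    unfolding u_def by (rule set_integrable_ln_norm_holomorphic[OF hol r c])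
  have "{a. a \<in> ball 0 r \<and> \<phi> a = c} \<in> null_sets lborel"
    using finite_preimages_ball[OF hol r(2) c] by (intro finite_imp_null_set_lborel)
  then have "AE z in lborel. z \<notin> {a. a \<in> ball 0 r \<and> \<phi> a = c}" by (rule AE_not_in)
  then have AE: "AE z in lborel. (LINT \<zeta>|lborel. f (z, \<zeta>)) - pi * R\<^sup>2 * (indicator (ball 0 r) z *\<^sub>R u z)
     = indicator (ball 0 r) z *\<^sub>R disc_potential R (norm (\<phi> z - c))"
  proof eventually_elim
    case (elim z)
    show ?case
    proof (cases "z \<in> ball 0 r")
      case True
      then have "(LINT \<zeta>|lborel. f (z, \<zeta>)) = (LINT \<zeta>:ball c R|lborel. ln (norm (\<phi> z - \<zeta>)))"
        by (simp add: f set_lebesgue_integral_def)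
      also have "\<dots> = pi * R\<^sup>2 * u z + disc_potential R (norm (\<phi> z - c))"
        unfolding u_def by (rule set_integral_ln_norm_diff) (use R elim True in auto)
      finally show ?thesis using True by simp
    qed (simp add: f)
  qed
  have int_f: "integrable lborel (\<lambda>z. LINT \<zeta>|lborel. f (z, \<zeta>))"
    by (rule lborel_pair.integrable_fst[OF int'])
  have int_fu: "integrable lborel (\<lambda>z. (LINT \<zeta>|lborel. f (z, \<zeta>)) - pi * R\<^sup>2 * (indicator (ball 0 r) z *\<^sub>R u z))"
    using int_u unfolding set_integrable_def by (intro Bochner_Integration.integrable_diff int_f integrable_mult_right)
  have "(\<lambda>z. indicator (ball 0 r) z *\<^sub>R disc_potential R (norm (indicator (ball 0 r) z *\<^sub>R \<phi> z - c)))
      \<in> borel_measurable lborel" by measurable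
  also have "(\<lambda>z. indicator (ball 0 r) z *\<^sub>R disc_potential R (norm (indicator (ball 0 r) z *\<^sub>R \<phi> z - c)))
      = (\<lambda>z. indicator (ball 0 r) z *\<^sub>R disc_potential R (norm (\<phi> z - c)))"
    by (auto simp: indicator_def)
  finally have meas: "(\<lambda>z. indicator (ball 0 r) z *\<^sub>R disc_potential R (norm (\<phi> z - c))) \<in> borel_measurable lborel" .
  show "set_integrable lborel (ball 0 r) (\<lambda>z. disc_potential R (norm (\<phi> z - c)))"
    unfolding set_integrable_def by (rule integrable_cong_AE_imp[OF int_fu meas AE])
  have eq: "(LINT z:ball 0 r|lborel. disc_potential R (norm (\<phi> z - c)))
      = (LINT z|lborel. (LINT \<zeta>|lborel. f (z, \<zeta>)) - pi * R\<^sup>2 * (indicator (ball 0 r) z *\<^sub>R u z))"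
    unfolding set_lebesgue_integral_def
    by (rule integral_cong_AE[OF meas borel_measurable_integrable[OF int_fu]]) (use AE in eventually_elim, simp)
  also have "\<dots> = (LINT z|lborel. (LINT \<zeta>|lborel. f (z, \<zeta>))) - pi * R\<^sup>2 * (LINT z:ball 0 r|lborel. u z)"
    using int_u unfolding set_integrable_def set_lebesgue_integral_def
    by (subst Bochner_Integration.integral_diff[OF int_f]) auto
  also have "(LINT z|lborel. (LINT \<zeta>|lborel. f (z, \<zeta>))) = (LINT \<zeta>|lborel. (LINT z|lborel. f (z, \<zeta>)))"
    by (rule lborel_pair.Fubini_integral[OF int', symmetric])
  also have "\<dots> = (LINT \<zeta>:ball c R|lborel. A \<zeta>)"
    by (simp add: A set_lebesgue_integral_def)
  finally have 1: "(LINT \<zeta>:ball c R|lborel. A \<zeta>) = pi * R\<^sup>2 * A c + (LINT z:ball 0 r|lborel. disc_potential R (norm (\<phi> z - c)))"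
    by (simp add: u_def A_def)
  have "(LINT \<zeta>:ball c R|lborel. area_counting \<phi> r \<zeta>)
      = (LINT \<zeta>:ball c R|lborel. A \<zeta>) - (LINT \<zeta>:ball c R|lborel. pi * r\<^sup>2 * ln (norm (\<phi> 0 - \<zeta>)))"
    unfolding J by (intro set_integral_diff set_integrable_mult_right int_A int_0)
  also have "(LINT \<zeta>:ball c R|lborel. pi * r\<^sup>2 * ln (norm (\<phi> 0 - \<zeta>))) = pi * r\<^sup>2 * (pi * R\<^sup>2 * ln (norm (\<phi> 0 - c)))"
    using set_integral_ln_norm_diff[of R "\<phi> 0" c] R c by (simp add: disc_potential_eq_0)
  finally show "(LINT \<zeta>:ball c R|lborel. area_counting \<phi> r \<zeta>)
      = pi * R\<^sup>2 * area_counting \<phi> r c + (LINT z:ball 0 r|lborel. disc_potential R (norm (\<phi> z - c)))"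
    by (simp add: 1 J algebra_simps)
qed

section \<open>Carleson windows and comparison of the counting functions\<close>

lemma measurable_Arg: "Arg \<in> borel_measurable borel"
proof -
  have "Arg = (\<lambda>z. if z = 0 then 0 else Im (Ln z))"
    by (auto simp: fun_eq_iff Arg_eq_Im_Ln Arg_zero)
  also have "\<dots> \<in> borel_measurable borel" by measurable
  finally show ?thesis .
qed

lemma carleson_window_borel: "carleson_window \<xi> h \<in> sets borel"
proof -
  note measurable_Arg [measurable]
  show ?thesis unfolding carleson_window_def by measurable
qed

lemma preimage_borel:
  assumes hol: "\<phi> holomorphic_on ball 0 1" and W: "W \<in> sets borel" and r: "r \<le> 1"
  shows "{z. norm z < r \<and> \<phi> z \<in> W} \<in> sets (borel :: complex measure)"
proof -
  have "continuous_on (ball 0 r) \<phi>"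
    by (intro holomorphic_on_imp_continuous_on holomorphic_on_subset[OF hol]) (use r in auto)
  then have "\<phi> \<in> borel_measurable (restrict_space borel (ball 0 r))"
    by (rule borel_measurable_continuous_on_restrict)
  from measurable_sets[OF this W] have "\<phi> -` W \<inter> ball 0 r \<in> sets (restrict_space borel (ball 0 r))"
    by (simp add: space_restrict_space)
  then have "\<phi> -` W \<inter> ball 0 r \<in> sets borel"
    by (subst (asm) sets_restrict_space_iff) auto
  also have "\<phi> -` W \<inter> ball 0 r = {z. norm z < r \<and> \<phi> z \<in> W}" by auto
  finally show ?thesis .
qed

text \<open>After rotation, v - 1 = (|v| - 1) e^(i Arg v) + (e^(i Arg v) - 1): the radial part is at
  most h, the chord at most its arc pi h. This inclusion and its converse below allow windows to be
  replaced by discs, to which the radial potentials are suited.\<close>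

lemma carleson_window_subset_ball:
  assumes \<xi>: "norm \<xi> = 1"
  shows "carleson_window \<xi> h \<subseteq> cball \<xi> ((1 + pi) * h)"
proof
  fix z assume z: "z \<in> carleson_window \<xi> h"
  let ?v = "z * cnj \<xi>"
  have \<xi>\<xi>: "\<xi> * cnj \<xi> = 1" using \<xi> complex_norm_square[of \<xi>] by simp
  have nv: "norm ?v = norm z" using \<xi> by (simp add: norm_mult)
  have "norm (z - \<xi>) = norm ((z - \<xi>) * cnj \<xi>)" using \<xi> by (simp add: norm_mult)
  also have "(z - \<xi>) * cnj \<xi> = ?v - 1" by (simp add: algebra_simps \<xi>\<xi>)
  also have "?v - 1 = of_real (norm z - 1) * cis (Arg ?v) + (cis (Arg ?v) - 1)"
    using rcis_cmod_Arg[of ?v] unfolding rcis_def nv by (simp add: algebra_simps)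
  also have "norm \<dots> \<le> norm (of_real (norm z - 1) * cis (Arg ?v)) + norm (cis (Arg ?v) - 1)"
    by (rule norm_triangle_ineq)
  also have "norm (of_real (norm z - 1) * cis (Arg ?v)) = \<bar>norm z - 1\<bar>"
    by (simp only: norm_mult norm_of_real norm_cis mult_1_right)
  also have "\<dots> \<le> h" using z by (auto simp: carleson_window_def)
  also have "norm (cis (Arg ?v) - 1) = 2 * \<bar>sin (Arg ?v / 2)\<bar>"
    using dist_exp_i_1[of "Arg ?v"] by (simp add: cis_conv_exp mult.commute)
  also have "\<dots> \<le> \<bar>Arg ?v\<bar>" using abs_sin_x_le_abs_x[of "Arg ?v / 2"] by simp
  also have "\<dots> \<le> pi * h" using z by (auto simp: carleson_window_def)
  finally show "z \<in> cball \<xi> ((1 + pi) * h)"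
    by (simp add: dist_norm norm_minus_commute algebra_simps)
qed

text \<open>The angle is the imaginary part of Ln(1 + u) with |u| < h < 1/2, and |Ln(1 + u)| <= 2|u|
  <= pi h.\<close>

lemma ball_subset_carleson_window:
  assumes \<xi>: "norm \<xi> = 1" and h: "h < 1/2"
  shows "ball \<xi> h \<inter> ball 0 1 \<subseteq> carleson_window \<xi> h"
proof
  fix z assume z: "z \<in> ball \<xi> h \<inter> ball 0 1"
  let ?v = "z * cnj \<xi>"
  have d: "norm (z - \<xi>) < h" using z by (simp add: dist_norm norm_minus_commute)
  have \<xi>\<xi>: "\<xi> * cnj \<xi> = 1" using \<xi> complex_norm_square[of \<xi>] by simp
  have "(z - \<xi>) * cnj \<xi> = ?v - 1" by (simp add: algebra_simps \<xi>\<xi>)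
  then have nv: "norm (?v - 1) = norm (z - \<xi>)" using \<xi> by (metis complex_mod_cnj mult_1_right norm_mult)
  have nz: "norm z \<ge> 1 - h" using d \<xi> norm_triangle_ineq3[of z \<xi>] by linarith
  then have v0: "?v \<noteq> 0" using h \<xi> by auto
  have "\<bar>Arg ?v\<bar> = \<bar>Im (Ln (1 + (?v - 1)))\<bar>" using v0 by (simp add: Arg_eq_Im_Ln)
  also have "\<dots> \<le> norm (Ln (1 + (?v - 1)))" by (rule abs_Im_le_cmod)
  also have "\<dots> \<le> 2 * norm (?v - 1)" by (rule norm_Ln_le) (use nv d h in linarith)
  also have "\<dots> \<le> pi * h" using nv d pi_ge_two by (intro mult_mono) auto
  finally show "z \<in> carleson_window \<xi> h" using nz z by (simp add: carleson_window_def)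
qed

section \<open>The potential as a Nevanlinna weight of order 2\<close>

text \<open>In the annulus bound, r^2 - s^2 <= 1 - s^2 <= 2(1 - s) <= 2 ln(1/s) supplies the second
  logarithm.\<close>

lemma disc_potential_le_ln_square:
  assumes a: "0 < s" "s < r" "r < 1"
  shows "disc_potential r s \<le> 2 * pi * (ln (1 / s))\<^sup>2"
proof -
  have T: "1 - s \<le> ln (1 / s)" using a ln_le_minus_one[of s] by (simp add: ln_div)
  have "disc_potential r s \<le> pi * (r\<^sup>2 - s\<^sup>2) * ln (r / s)" using a by (intro disc_potential_le) auto
  also have "\<dots> \<le> pi * (2 * (1 - s)) * ln (1 / s)"
  proof (intro mult_mono mult_left_mono ln_mono divide_right_mono)
    have "r\<^sup>2 \<le> 1" using a by (simp add: power_le_one)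
    then show "r\<^sup>2 - s\<^sup>2 \<le> 2 * (1 - s)" using sum_squares_bound[of s 1] by simp
  qed (use a in \<open>auto simp: ln_div\<close>)
  also have "\<dots> \<le> pi * (2 * ln (1 / s)) * ln (1 / s)"
    using T a by (intro mult_right_mono mult_left_mono) auto
  finally show ?thesis by (simp add: power2_eq_square)
qed

text \<open>The geometric mean q = sqrt(r s) gives ln(q/s) = ln(r/s)/2 and r^2 - q^2 = r(r - s).
  Since s >= r/2, also r - s >= (r/2) ln(r/s); the two halves make the factor 1/4.\<close>

lemma ln_square_le_disc_potential:
  assumes a: "0 < s" "s \<le> r" "r \<le> 2 * s"
  shows "pi * r\<^sup>2 / 4 * (ln (r / s))\<^sup>2 \<le> disc_potential r s"
proof -
  define t where "t = ln (r / s)"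
  have t: "t \<ge> 0" using a by (simp add: t_def)
  have "t \<le> r / s - 1" unfolding t_def using a by (intro ln_le_minus_one) auto
  also have "\<dots> = (r - s) / s" using a by (simp add: field_simps)
  also have "\<dots> \<le> (r - s) / (r / 2)" using a by (intro divide_left_mono) auto
  finally have tr: "r * (r * t / 2) \<le> r * (r - s)"
    using a by (intro mult_left_mono) (auto simp: field_simps)
  have sq: "sqrt (r * s) / s = sqrt (r / s)"
    using a by (simp add: real_sqrt_mult real_sqrt_divide field_simps)
  have "pi * r\<^sup>2 / 4 * t\<^sup>2 = pi * (r * (r * t / 2)) * (t / 2)" by (simp add: power2_eq_square)
  also have "\<dots> \<le> pi * (r * (r - s)) * (t / 2)"
    by (rule mult_right_mono[OF mult_left_mono[OF tr]]) (use t in auto)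
  also have "\<dots> = pi * (r\<^sup>2 - (sqrt (r * s))\<^sup>2) * ln (sqrt (r * s) / s)"
    using a unfolding sq t_def by (simp add: ln_sqrt power2_eq_square algebra_simps)
  also have "\<dots> \<le> disc_potential r s"
  proof (rule disc_potential_ge)
    show "s \<le> sqrt (r * s)" using a by (intro real_le_rsqrt) (simp add: power2_eq_square)
    show "sqrt (r * s) \<le> r" using a by (intro real_le_lsqrt) (auto simp: power2_eq_square)
  qed (use a in auto)
  finally show ?thesis by (simp add: t_def)
qed

text \<open>The preimages of modulus below \<open>r\<close> form a finite set, so their weighted sum
  is one of the partial sums whose supremum is \<open>nevanlinna2\<close>.\<close>

lemma area_counting_le_nevanlinna2:
  assumes hol: "\<phi> holomorphic_on ball 0 1" and r: "0 < r" "r < 1" and w: "w \<noteq> \<phi> 0"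
    and N: "nevanlinna2 \<phi> w \<le> ennreal s" and s: "s \<ge> 0"
  shows "area_counting \<phi> r w \<le> 2 * pi * s"
proof -
  let ?Z = "{a. a \<in> ball 0 r \<and> \<phi> a = w}"
  define m where "m = (\<lambda>a. real (nat (zorder (\<lambda>u. \<phi> u - w) a)))"
  have fin: "finite ?Z" using finite_preimages_ball[OF hol r(2)] w by auto
  have "ennreal (\<Sum>a\<in>?Z. m a * (ln (1 / norm a))\<^sup>2) = (\<Sum>a\<in>?Z. ennreal (m a * (ln (1 / norm a))\<^sup>2))"
    by (simp add: m_def)
  also have "\<dots> \<le> nevanlinna2 \<phi> w"
    using w fin r unfolding nevanlinna2_def m_def
    by (auto simp: nonneg_infsum_complete intro!: SUP_upper)
  also note N
  finally have sum: "(\<Sum>a\<in>?Z. m a * (ln (1 / norm a))\<^sup>2) \<le> s"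
    using s by (simp add: ennreal_le_iff)
  have "area_counting \<phi> r w = (\<Sum>a\<in>?Z. of_int (zorder (\<lambda>u. \<phi> u - w) a) * disc_potential r (norm a))"
    using w by (intro area_counting_eq[OF hol r]) auto
  also have "\<dots> \<le> (\<Sum>a\<in>?Z. m a * (2 * pi * (ln (1 / norm a))\<^sup>2))"
  proof (intro sum_mono mult_mono disc_potential_nonneg)
    fix a assume a: "a \<in> ?Z"
    then have "a \<noteq> 0" using w by auto
    then show "disc_potential r (norm a) \<le> 2 * pi * (ln (1 / norm a))\<^sup>2"
      using a r by (intro disc_potential_le_ln_square) auto
  qed (auto simp: m_def)
  also have "\<dots> = 2 * pi * (\<Sum>a\<in>?Z. m a * (ln (1 / norm a))\<^sup>2)"
    by (simp add: sum_distrib_left mult_ac)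
  also have "\<dots> \<le> 2 * pi * s" using sum by simp
  finally show ?thesis .
qed

lemma area_meas_mono:
  assumes "S \<subseteq> T" "S \<in> sets borel" "T \<in> sets borel" "T \<subseteq> ball 0 1"
  shows "area_meas S \<le> area_meas T"
proof -
  have "T \<in> lmeasurable"
    using assms by (intro bounded_set_imp_lmeasurable bounded_subset[OF bounded_ball]) auto
  then show ?thesis
    unfolding area_meas_def using assms by (intro divide_right_mono measure_mono_fmeasurable) auto
qed

text \<open>The real-valued supremum in \<open>rho2\<close> is a true upper bound because all the
  areas are dominated by that of the unit disc.\<close>

lemma area_meas_le_rho2:
  assumes hol: "\<phi> holomorphic_on ball 0 1" and \<xi>: "norm \<xi> = 1"
  shows "area_meas {z. norm z < 1 \<and> \<phi> z \<in> carleson_window \<xi> h} \<le> rho2 \<phi> h"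
  unfolding rho2_def
proof (rule cSUP_upper)
  show "\<xi> \<in> sphere 0 1" using \<xi> by simp
  show "bdd_above ((\<lambda>\<xi>. area_meas {z. norm z < 1 \<and> \<phi> z \<in> carleson_window \<xi> h}) ` sphere 0 1)"
  proof (rule bdd_aboveI2)
    fix \<xi> show "area_meas {z. norm z < 1 \<and> \<phi> z \<in> carleson_window \<xi> h} \<le> area_meas (ball 0 1)"
      by (intro area_meas_mono preimage_borel[OF hol carleson_window_borel]) auto
  qed
qed

lemma area_counting_outside:
  assumes hol: "\<phi> holomorphic_on ball 0 1" and maps: "\<phi> ` ball 0 1 \<subseteq> ball 0 1"
    and r: "0 < r" "r < 1" and w: "norm w \<ge> 1"
  shows "area_counting \<phi> r w = 0"
proof -
  have ne: "\<phi> a \<noteq> w" if "a \<in> ball 0 1" for a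
    using maps that w by (force simp: image_subset_iff)
  have empty: "{a. a \<in> ball 0 r \<and> \<phi> a = w} = {}" using ne r by auto
  show ?thesis using area_counting_eq[OF hol r ne[of 0]] unfolding empty by simp
qed

lemma ln_6_5_ge: "ln (6/5) \<ge> (1/6 :: real)"
  using ln_le_minus_one[of "5/6 :: real"] by (simp add: ln_div)

section \<open>The lower estimate for the counting function\<close>

lemma window_le_counting:
  assumes hol: "\<phi> holomorphic_on ball 0 1" and maps: "\<phi> ` ball 0 1 \<subseteq> ball 0 1"
    and h: "0 < h" "norm (\<phi> 0) < 1 - h" and \<xi>: "norm \<xi> = 1" and s: "s \<ge> 0"
    and N: "\<And>w. norm w < 1 \<Longrightarrow> norm w \<ge> 1 - h \<Longrightarrow> nevanlinna2 \<phi> w \<le> ennreal s"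
  shows "area_meas {z. norm z < 1 \<and> \<phi> z \<in> carleson_window \<xi> (h / 100)} \<le> 100 * s"
proof -
  let ?W = "carleson_window \<xi> (h / 100)"
  define P where "P = of_real (1 + h) * \<xi>"
  have normP: "norm P = 1 + h" using \<xi> h unfolding P_def norm_mult norm_of_real by simp
  have P\<xi>: "norm (P - \<xi>) = h"
  proof -
    have "P - \<xi> = of_real h * \<xi>" by (simp add: P_def algebra_simps)
    then show ?thesis using \<xi> h by (simp add: norm_mult)
  qed
  \<comment> \<open>The disc of radius 2h about P lies in |zeta| > 1 - h, where the assumption on
    \<open>nevanlinna2\<close> is available, and it avoids phi(0).\<close>
  have R: "0 < 2 * h" "2 * h \<le> norm (\<phi> 0 - P)"
    using h normP norm_triangle_ineq3[of "\<phi> 0" P] by linarith+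
  define T where "T = (\<lambda>r. {z. norm z < r \<and> \<phi> z \<in> ?W})"
  have T_borel: "T r \<in> sets borel" if "r \<le> 1" for r
    unfolding T_def by (rule preimage_borel[OF hol carleson_window_borel that])
  have bound: "measure lborel (T r) \<le> 100 * pi * s" if r: "0 < r" "r < 1" for r
  proof -
    \<comment> \<open>This is the lower bound of \<open>disc_potential_ge\<close> with outer radius
      2h, q = 3h/2 and d <= 5h/4: (4 - 9/4)/6 = 7/24, where 1/6 bounds ln(6/5) =
      ln((3/2)/(5/4)).\<close>
    define k where "k = pi * (7/24) * h\<^sup>2"
    have ge: "k \<le> disc_potential (2 * h) (norm (\<phi> z - P))" if z: "norm z < r" "\<phi> z \<in> ?W" for z
    proof -
      let ?d = "norm (\<phi> z - P)"
      have "norm (\<phi> z) < 1" using maps z r by (force simp: image_subset_iff)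
      then have d0: "0 < ?d" using normP h by auto
      \<comment> \<open>Shrinking the window to h/100 absorbs the factor 1 + pi < 5 and leaves
        phi(z) within h/4 of xi.\<close>
      have "norm (\<phi> z - \<xi>) \<le> (1 + pi) * (h / 100)"
        using subsetD[OF carleson_window_subset_ball[OF \<xi>] z(2)]
        by (simp add: dist_norm norm_minus_commute)
      also have "\<dots> \<le> h / 4" using pi_less_4 h by (simp add: field_simps)
      finally have d: "?d \<le> 5/4 * h"
        using norm_triangle_ineq4[of "\<phi> z - \<xi>" "P - \<xi>"] P\<xi> by simp
      have "k = pi * ((2 * h)\<^sup>2 - (3/2 * h)\<^sup>2) * (1/6)"
        by (simp add: k_def power2_eq_square)
      also have "\<dots> \<le> pi * ((2 * h)\<^sup>2 - (3/2 * h)\<^sup>2) * ln (3/2 * h / ?d)"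
      proof (rule mult_left_mono)
        have "1/6 \<le> ln (6/5 :: real)" by (rule ln_6_5_ge)
        also have "\<dots> \<le> ln (3/2 * h / ?d)"
          using d d0 h by (intro ln_mono) (auto simp: field_simps)
        finally show "1/6 \<le> ln (3/2 * h / ?d)" .
        show "0 \<le> pi * ((2 * h)\<^sup>2 - (3/2 * h)\<^sup>2)" using h by (simp add: power2_eq_square)
      qed
      also have "\<dots> \<le> disc_potential (2 * h) ?d"
        using d d0 h by (intro disc_potential_ge) auto
      finally show ?thesis .
    qed
    have fin: "emeasure lborel (T r) < \<infinity>"
      by (intro emeasure_bounded_finite bounded_subset[OF bounded_ball[of 0 r]]) (auto simp: T_def)
    have "k * measure lborel (T r) = (LINT z|lborel. k * indicator (T r) z)"
      using T_borel[of r] r by simp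
    also have "\<dots> \<le> (LINT z:ball 0 r|lborel. disc_potential (2 * h) (norm (\<phi> z - P)))"
      unfolding set_lebesgue_integral_def
    proof (rule integral_mono)
      show "integrable lborel (\<lambda>z. k * indicator (T r) z)"
        using fin T_borel[of r] r by (intro integrable_mult_right integrable_real_indicator) auto
      show "integrable lborel (\<lambda>z. indicator (ball 0 r) z *\<^sub>R disc_potential (2 * h) (norm (\<phi> z - P)))"
        using set_integrable_disc_potential[OF hol r R] by (simp add: set_integrable_def)
      show "k * indicator (T r) z \<le> indicator (ball 0 r) z *\<^sub>R disc_potential (2 * h) (norm (\<phi> z - P))" for z
        using ge[of z] disc_potential_nonneg by (auto simp: T_def indicator_def)
    qed
    also have "\<dots> = (LINT \<zeta>:ball P (2 * h)|lborel. area_counting \<phi> r \<zeta>)"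
      using set_integral_area_counting[OF hol r R] area_counting_outside[OF hol maps r, of P] normP h by simp
    also have "\<dots> \<le> (LINT \<zeta>:ball P (2 * h)|lborel. 2 * pi * s)"
    proof (rule set_integral_mono[OF set_integrable_area_counting[OF hol r R] set_integrable_const_ball])
      fix \<zeta> assume \<zeta>: "\<zeta> \<in> ball P (2 * h)"
      then have n\<zeta>: "norm \<zeta> > 1 - h"
        using normP norm_triangle_ineq3[of P \<zeta>] by (simp add: dist_norm)
      show "area_counting \<phi> r \<zeta> \<le> 2 * pi * s"
      \<comment> \<open>About the outer part of the disc the assumption says nothing, but there the
        area counting function vanishes.\<close>
      proof (cases "norm \<zeta> < 1")
        case True
        show ?thesis
          using n\<zeta> h by (intro area_counting_le_nevanlinna2[OF hol r _ N[OF True] s]) auto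
      next
        case False
        then show ?thesis using area_counting_outside[OF hol maps r, of \<zeta>] s by simp
      qed
    qed
    also have "\<dots> = 8 * pi\<^sup>2 * h\<^sup>2 * s"
      using h by (simp add: set_lebesgue_integral_def measure_ball_complex power2_eq_square)
    \<comment> \<open>Cancelling pi h^2 leaves measure <= (192/7) pi s, well below 100 pi s.\<close>
    finally have "h\<^sup>2 * pi * (7/24 * measure lborel (T r)) \<le> h\<^sup>2 * pi * (8 * pi * s)"
      by (simp add: k_def power2_eq_square mult_ac)
    then have "7/24 * measure lborel (T r) \<le> 8 * pi * s"
      using h by (subst (asm) mult_le_cancel_left_pos) auto
    moreover have "0 \<le> pi * s" using s by simp
    ultimately show ?thesis by linarith
  qed
  \<comment> \<open>Exhaustion by radii tending to 1; the shift by 2 keeps the first radius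
    positive, as \<open>bound\<close> requires.\<close>
  define F where "F = (\<lambda>n::nat. T (1 - 1 / real (n + 2)))"
  have F_borel: "F n \<in> sets borel" for n unfolding F_def by (intro T_borel) simp
  have "incseq F"
    unfolding F_def T_def by (intro incseq_SucI) (auto intro: less_le_trans simp: frac_le)
  have "(\<Union>n. F n) = T 1"
  proof (intro equalityI subsetI)
    fix z assume z: "z \<in> T 1"
    then have "0 < 1 - norm z" by (simp add: T_def)
    then obtain n where n: "n \<noteq> 0" "inverse (real n) < 1 - norm z"
      using real_arch_inverse[THEN iffD1] by blast
    have "1 / real (n + 2) \<le> inverse (real n)" using n by (simp add: field_simps)
    then have "z \<in> F n" using n z unfolding F_def T_def mem_Collect_eq by linarith
    then show "z \<in> (\<Union>n. F n)" by blast
  next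
    fix z assume "z \<in> (\<Union>n. F n)"
    then obtain n where "z \<in> F n" by blast
    moreover have "1 / real (n + 2) > 0" by simp
    ultimately show "z \<in> T 1" unfolding F_def T_def mem_Collect_eq by linarith
  qed
  then have "emeasure lborel (T 1) = (SUP n. emeasure lborel (F n))"
    using F_borel \<open>incseq F\<close> by (subst SUP_emeasure_incseq) auto
  also have "\<dots> \<le> ennreal (100 * pi * s)"
  proof (rule SUP_least)
    fix n
    have fin: "emeasure lborel (F n) < \<infinity>"
      by (intro emeasure_bounded_finite bounded_subset[OF bounded_ball[of 0 "1 - 1 / real (n + 2)"]])
         (auto simp: F_def T_def)
    have "measure lborel (F n) \<le> 100 * pi * s" unfolding F_def by (rule bound) auto
    then show "emeasure lborel (F n) \<le> ennreal (100 * pi * s)"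
      using fin by (simp add: emeasure_eq_ennreal_measure ennreal_leI)
  qed
  finally have "measure lborel (T 1) \<le> 100 * pi * s"
    unfolding measure_def using s by (intro enn2real_leI) auto
  then show ?thesis
    using T_borel[of 1] by (simp add: area_meas_def T_def field_simps)
qed

section \<open>The upper estimate for the counting function\<close>

text \<open>\<open>away\<close> serves twice: it separates phi(0) from the discs about w and P, and
  it pushes all preimages of \<open>w\<close> beyond radius 1/2. The bound 1/200 makes 100 h < 1/2,
  so that a disc of that radius about xi meets the unit disc inside the window.\<close>

lemma counting_le_window:
  assumes hol: "\<phi> holomorphic_on ball 0 1" and maps: "\<phi> ` ball 0 1 \<subseteq> ball 0 1"
    and h: "0 < h" "h < 1/200" and away: "\<And>z. z \<in> cball 0 (1/2) \<Longrightarrow> norm (\<phi> z) < 1 - 5 * h"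
    and w: "norm w < 1" "norm w \<ge> 1 - h"
  shows "nevanlinna2 \<phi> w \<le> ennreal (100 * rho2 \<phi> (100 * h))"
proof -
  have \<phi>0: "norm (\<phi> 0) < 1 - 5 * h" by (rule away) simp
  have w0: "w \<noteq> 0" using w h by auto
  define \<xi> where "\<xi> = w / of_real (norm w)"
  have \<xi>: "norm \<xi> = 1" using w0 by (simp add: \<xi>_def norm_divide)
  define P where "P = of_real (1 + h) * \<xi>"
  have normP: "norm P = 1 + h" using \<xi> h unfolding P_def norm_mult norm_of_real by simp
  have Pw: "norm (P - w) \<le> 2 * h"
  proof -
    have "P - w = of_real (1 + h - norm w) * \<xi>" using w0 by (simp add: P_def \<xi>_def field_simps)
    then have "norm (P - w) = \<bar>1 + h - norm w\<bar>" using \<xi> by (simp only: norm_mult norm_of_real mult_1_right)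
    then show ?thesis using w h by simp
  qed
  have P\<xi>: "norm (P - \<xi>) = h"
  proof -
    have "P - \<xi> = of_real h * \<xi>" by (simp add: P_def algebra_simps)
    then show ?thesis using \<xi> h by (simp add: norm_mult)
  qed
  have R: "0 < 3 * h" "3 * h \<le> norm (\<phi> 0 - P)"
    using h \<phi>0 normP norm_triangle_ineq3[of "\<phi> 0" P] by linarith+
  have Rw: "h \<le> norm (\<phi> 0 - w)"
    using h \<phi>0 w norm_triangle_ineq3[of "\<phi> 0" w] by linarith
  \<comment> \<open>\<open>A\<close> is the part of the unit disc where the potential of the disc
    about P can be nonzero; phi maps it within 4h < 100h of xi.\<close>
  define A where "A = {z. norm z < 1 \<and> \<phi> z \<in> ball P (3 * h)}"
  have A_borel: "A \<in> sets borel" unfolding A_def by (intro preimage_borel[OF hol]) auto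
  have "area_meas A \<le> area_meas {z. norm z < 1 \<and> \<phi> z \<in> carleson_window \<xi> (100 * h)}"
  proof (intro area_meas_mono A_borel preimage_borel[OF hol carleson_window_borel])
    have "\<phi> z \<in> carleson_window \<xi> (100 * h)" if "norm z < 1" "\<phi> z \<in> ball P (3 * h)" for z
    proof -
      have "norm (\<phi> z - \<xi>) < 100 * h"
        using that(2) norm_triangle_ineq[of "\<phi> z - P" "P - \<xi>"] P\<xi> h by (simp add: dist_norm norm_minus_commute)
      moreover have "norm (\<phi> z) < 1" using maps that by (force simp: image_subset_iff)
      ultimately show ?thesis
        using ball_subset_carleson_window[OF \<xi>, of "100 * h"] h by (auto simp: dist_norm norm_minus_commute)
    qed
    then show "A \<subseteq> {z. norm z < 1 \<and> \<phi> z \<in> carleson_window \<xi> (100 * h)}" by (auto simp: A_def)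
  qed auto
  also have "\<dots> \<le> rho2 \<phi> (100 * h)" by (rule area_meas_le_rho2[OF hol \<xi>])
  finally have A_rho: "measure lborel A \<le> pi * rho2 \<phi> (100 * h)"
    using A_borel by (simp add: area_meas_def field_simps)
  have A_fin: "emeasure lborel A < \<infinity>"
    by (intro emeasure_bounded_finite bounded_subset[OF bounded_ball[of 0 1]]) (auto simp: A_def)
  have J: "area_counting \<phi> r w \<le> 18 * measure lborel A" if r: "0 < r" "r < 1" for r
  proof -
    \<comment> \<open>Since |phi(z)| < 1 and |P| = 1 + h, the distance exceeds h and the logarithm
      is at most ln 3 <= 2; with the squared radius 9h^2 this gives 18.\<close>
    have pw: "disc_potential (3 * h) (norm (\<phi> z - P)) \<le> 18 * pi * h\<^sup>2 * indicator A z" if z: "norm z < r" for z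
    proof -
      let ?d = "norm (\<phi> z - P)"
      have "norm (\<phi> z) < 1" using maps z r by (force simp: image_subset_iff)
      then have d: "h < ?d" using normP norm_triangle_ineq3[of "\<phi> z" P] by linarith
      show ?thesis
      proof (cases "?d < 3 * h")
        case True
        have "disc_potential (3 * h) ?d \<le> pi * ((3 * h)\<^sup>2 - ?d\<^sup>2) * ln (3 * h / ?d)"
          using d h True by (intro disc_potential_le) auto
        also have "\<dots> \<le> pi * (3 * h)\<^sup>2 * 2"
        proof (rule mult_mono)
          have "0 < ?d" using d h by linarith
          then have "3 * h / ?d \<le> 3" using d by (simp add: divide_le_eq)
          then show "ln (3 * h / ?d) \<le> 2"
            using ln_le_minus_one[of "3 * h / ?d"] divide_pos_pos[of "3 * h" ?d] \<open>0 < ?d\<close> h by linarith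
          show "0 \<le> ln (3 * h / ?d)" using True \<open>0 < ?d\<close> by (intro ln_ge_zero) (simp add: le_divide_eq)
        qed auto
        also have "\<dots> = 18 * pi * h\<^sup>2 * indicator A z"
          using True z r by (simp add: A_def dist_norm norm_minus_commute power2_eq_square)
        finally show ?thesis .
      next
        case False
        then have "0 < ?d" "3 * h \<le> ?d" using d h by linarith+
        then show ?thesis using disc_potential_eq_0[of ?d "3 * h"] by simp
      qed
    qed
    have "pi * h\<^sup>2 * area_counting \<phi> r w
        \<le> pi * h\<^sup>2 * area_counting \<phi> r w + (LINT z:ball 0 r|lborel. disc_potential h (norm (\<phi> z - w)))"
      unfolding set_lebesgue_integral_def
      by (simp add: Bochner_Integration.integral_nonneg disc_potential_nonneg)
    also have "\<dots> = (LINT \<zeta>:ball w h|lborel. area_counting \<phi> r \<zeta>)"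
      by (rule set_integral_area_counting[OF hol r h(1) Rw, symmetric])
    also have "\<dots> \<le> (LINT \<zeta>:ball P (3 * h)|lborel. area_counting \<phi> r \<zeta>)"
      unfolding set_lebesgue_integral_def
    proof (rule integral_mono)
      show "integrable lborel (\<lambda>\<zeta>. indicator (ball w h) \<zeta> *\<^sub>R area_counting \<phi> r \<zeta>)"
        using set_integrable_area_counting[OF hol r h(1) Rw] by (simp add: set_integrable_def)
      show "integrable lborel (\<lambda>\<zeta>. indicator (ball P (3 * h)) \<zeta> *\<^sub>R area_counting \<phi> r \<zeta>)"
        using set_integrable_area_counting[OF hol r R] by (simp add: set_integrable_def)
      fix \<zeta>
      have sub: "\<zeta> \<in> ball P (3 * h)" if "\<zeta> \<in> ball w h"
        using that Pw norm_triangle_ineq[of "P - w" "w - \<zeta>"] by (simp add: dist_norm)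
      \<comment> \<open>Enlarging the domain of integration only increases the integral because the
        area counting function is nonnegative there.\<close>
      have "area_counting \<phi> r \<zeta> \<ge> 0" if "\<zeta> \<in> ball P (3 * h)"
        using that R by (intro area_counting_nonneg[OF hol r]) (auto simp: dist_norm norm_minus_commute)
      then show "indicator (ball w h) \<zeta> *\<^sub>R area_counting \<phi> r \<zeta> \<le> indicator (ball P (3 * h)) \<zeta> *\<^sub>R area_counting \<phi> r \<zeta>"
        using sub by (cases "\<zeta> \<in> ball w h"; cases "\<zeta> \<in> ball P (3 * h)") auto
    qed
    also have "\<dots> = (LINT z:ball 0 r|lborel. disc_potential (3 * h) (norm (\<phi> z - P)))"
      using set_integral_area_counting[OF hol r R] area_counting_outside[OF hol maps r, of P] normP h by simp
    also have "\<dots> \<le> (LINT z|lborel. 18 * pi * h\<^sup>2 * indicator A z)"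
      unfolding set_lebesgue_integral_def
    proof (rule integral_mono)
      show "integrable lborel (\<lambda>z. indicator (ball 0 r) z *\<^sub>R disc_potential (3 * h) (norm (\<phi> z - P)))"
        using set_integrable_disc_potential[OF hol r R] by (simp add: set_integrable_def)
      show "integrable lborel (\<lambda>z. 18 * pi * h\<^sup>2 * indicator A z)"
        using A_fin A_borel by (intro integrable_mult_right integrable_real_indicator) auto
      show "indicator (ball 0 r) z *\<^sub>R disc_potential (3 * h) (norm (\<phi> z - P)) \<le> 18 * pi * h\<^sup>2 * indicator A z" for z
        using pw[of z] by (cases "norm z < r") auto
    qed
    also have "\<dots> = pi * h\<^sup>2 * (18 * measure lborel A)"
      using A_borel by simp
    finally show ?thesis using h by (subst (asm) mult_le_cancel_left_pos) auto
  qed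
  define m where "m = (\<lambda>a. real (nat (zorder (\<lambda>u. \<phi> u - w) a)))"
  have w\<phi>: "w \<noteq> \<phi> 0" using Rw h by auto
  have F: "(\<Sum>a\<in>F. m a * (ln (1 / norm a))\<^sup>2) \<le> 100 * rho2 \<phi> (100 * h)"
    if F: "finite F" "F \<subseteq> {z. norm z < 1 \<and> \<phi> z = w}" for F
  proof -
    have half: "norm a > 1/2" if "a \<in> F" for a
      using away[of a] F that w h by (force simp: not_less)
    \<comment> \<open>For a fixed finite set of preimages, every r close enough to 1 exceeds all
      their moduli, and |a| > 1/2 gives r <= 2|a|; the bound on the right is independent of
      r.\<close>
    have ev: "eventually (\<lambda>r. (\<Sum>a\<in>F. m a * (pi * r\<^sup>2 / 4 * (ln (r / norm a))\<^sup>2)) \<le> 18 * measure lborel A) (at_left 1)"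
    proof -
      have "eventually (\<lambda>r. \<forall>a\<in>F. norm a < r) (at_left 1)"
        using F by (intro eventually_ball_finite ballI eventually_at_left_real[THEN eventually_mono]) auto
      moreover have "eventually (\<lambda>r. r \<in> {0<..<1}) (at_left (1::real))"
        by (rule eventually_at_left_real) simp
      ultimately show ?thesis
      proof eventually_elim
        case (elim r)
        then have r: "0 < r" "r < 1" by auto
        have "(\<Sum>a\<in>F. m a * (pi * r\<^sup>2 / 4 * (ln (r / norm a))\<^sup>2)) \<le> (\<Sum>a\<in>F. m a * disc_potential r (norm a))"
        proof (intro sum_mono mult_left_mono ln_square_le_disc_potential)
          fix a assume "a \<in> F"
          then show "0 < norm a" "norm a \<le> r" "r \<le> 2 * norm a"
            using half[of a] elim r by (force+)
        qed (simp add: m_def)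
        also have "\<dots> \<le> (\<Sum>a | a \<in> ball 0 r \<and> \<phi> a = w. m a * disc_potential r (norm a))"
        proof (rule sum_mono2)
          show "finite {a. a \<in> ball 0 r \<and> \<phi> a = w}" using w\<phi> by (intro finite_preimages_ball[OF hol r(2)]) auto
          show "F \<subseteq> {a. a \<in> ball 0 r \<and> \<phi> a = w}" using F elim by auto
        qed (simp add: m_def disc_potential_nonneg)
        also have "\<dots> = area_counting \<phi> r w"
          unfolding area_counting_eq[OF hol r w\<phi>[symmetric]]
        proof (intro sum.cong refl)
          fix a assume "a \<in> {a. a \<in> ball 0 r \<and> \<phi> a = w}"
          then have "zorder (\<lambda>u. \<phi> u - w) a > 0"
            using r w\<phi> by (intro zorder_preimage_pos[OF hol]) auto
          then show "m a * disc_potential r (norm a) = of_int (zorder (\<lambda>u. \<phi> u - w) a) * disc_potential r (norm a)"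
            by (simp add: m_def)
        qed
        also have "\<dots> \<le> 18 * measure lborel A" by (rule J[OF r])
        finally show ?case .
      qed
    qed
    \<comment> \<open>Letting r tend to 1 turns the lower weights into pi/4 times the Nevanlinna
      weights.\<close>
    have "((\<lambda>r. \<Sum>a\<in>F. m a * (pi * r\<^sup>2 / 4 * (ln (r / norm a))\<^sup>2)) \<longlongrightarrow>
        (\<Sum>a\<in>F. m a * (pi * 1\<^sup>2 / 4 * (ln (1 / norm a))\<^sup>2))) (at_left 1)"
      using half by (intro tendsto_intros) (force simp: field_simps)+
    from tendsto_upperbound[OF this ev]
    have "(\<Sum>a\<in>F. m a * (pi * 1\<^sup>2 / 4 * (ln (1 / norm a))\<^sup>2)) \<le> 18 * measure lborel A" by simp
    also have "(\<Sum>a\<in>F. m a * (pi * 1\<^sup>2 / 4 * (ln (1 / norm a))\<^sup>2)) = pi * ((\<Sum>a\<in>F. m a * (ln (1 / norm a))\<^sup>2) / 4)"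
      by (simp add: sum_distrib_left sum_divide_distrib mult_ac)
    also note A_rho
    finally have "pi * ((\<Sum>a\<in>F. m a * (ln (1 / norm a))\<^sup>2) / 4) \<le> pi * (18 * rho2 \<phi> (100 * h))"
      by simp
    then have "(\<Sum>a\<in>F. m a * (ln (1 / norm a))\<^sup>2) / 4 \<le> 18 * rho2 \<phi> (100 * h)"
      by (subst (asm) mult_le_cancel_left_pos) auto
    \<comment> \<open>The estimate so far has the constant 4 * 18 = 72; nonnegativity of
      \<open>rho2\<close> allows it to be raised to 100.\<close>
    moreover have "rho2 \<phi> (100 * h) \<ge> 0"
      using A_rho measure_nonneg[of lborel A] by (smt (verit) mult_pos_neg pi_gt_zero)
    ultimately show ?thesis by simp
  qed
  \<comment> \<open>\<open>w\<close> may have infinitely many preimages; the sum in [0, infinity] is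
    the supremum of its finite partial sums, and each of them has been bounded by
    \<open>F\<close>.\<close>
  have "nevanlinna2 \<phi> w = (SUP F\<in>{F. finite F \<and> F \<subseteq> {z. norm z < 1 \<and> \<phi> z = w}}.
      \<Sum>a\<in>F. ennreal (m a * (ln (1 / norm a))\<^sup>2))"
    using w\<phi> by (simp add: nevanlinna2_def m_def nonneg_infsum_complete)
  also have "\<dots> \<le> ennreal (100 * rho2 \<phi> (100 * h))"
  proof (rule SUP_least)
    fix F assume "F \<in> {F. finite F \<and> F \<subseteq> {z. norm z < 1 \<and> \<phi> z = w}}"
    then have "ennreal (\<Sum>a\<in>F. m a * (ln (1 / norm a))\<^sup>2) \<le> ennreal (100 * rho2 \<phi> (100 * h))"
      by (intro ennreal_leI F) auto
    then show "(\<Sum>a\<in>F. ennreal (m a * (ln (1 / norm a))\<^sup>2)) \<le> ennreal (100 * rho2 \<phi> (100 * h))"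
      by (simp add: m_def)
  qed
  finally show ?thesis .
qed

theorem theorem3p10:
  shows "\<exists>C::real. C > 1 \<and>
    (\<forall>\<phi>::complex \<Rightarrow> complex.
       \<phi> holomorphic_on ball 0 1 \<and> \<phi> ` ball 0 1 \<subseteq> ball 0 1 \<longrightarrow>
       (\<exists>h0>0. \<forall>h::real. 0 < h \<and> h < 1 \<and> h < h0 \<longrightarrow>
          ennreal (rho2 \<phi> (h / C) / C)
            \<le> (SUP w\<in>{w. norm w < 1 \<and> norm w \<ge> 1 - h}. nevanlinna2 \<phi> w)
          \<and> (SUP w\<in>{w. norm w < 1 \<and> norm w \<ge> 1 - h}. nevanlinna2 \<phi> w)
            \<le> ennreal (C * rho2 \<phi> (C * h))))"
proof (rule exI[of _ 100], intro conjI allI impI)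
  fix \<phi> :: "complex \<Rightarrow> complex"
  assume "\<phi> holomorphic_on ball 0 1 \<and> \<phi> ` ball 0 1 \<subseteq> ball 0 1"
  then have hol: "\<phi> holomorphic_on ball 0 1" and maps: "\<phi> ` ball 0 1 \<subseteq> ball 0 1" by auto
  have "continuous_on (cball 0 (1/2)) (\<lambda>z. norm (\<phi> z))"
    by (intro continuous_on_norm holomorphic_on_imp_continuous_on holomorphic_on_subset[OF hol]) auto
  from continuous_attains_sup[OF compact_cball _ this]
  obtain z0 where z0: "z0 \<in> cball 0 (1/2)" "\<And>z. z \<in> cball 0 (1/2) \<Longrightarrow> norm (\<phi> z) \<le> norm (\<phi> z0)"
    by auto
  have z0': "norm (\<phi> z0) < 1" using maps z0(1) by (force simp: image_subset_iff)
  \<comment> \<open>The maximum of |phi| on the closed half disc is attained, hence below 1;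
    dividing the gap by 5 yields the hypothesis \<open>away\<close>.\<close>
  define h0 where "h0 = min (1/200) ((1 - norm (\<phi> z0)) / 5)"
  have "0 < h0" using z0' by (simp add: h0_def)
  moreover have "ennreal (rho2 \<phi> (h / 100) / 100) \<le> (SUP w\<in>{w. norm w < 1 \<and> norm w \<ge> 1 - h}. nevanlinna2 \<phi> w)
      \<and> (SUP w\<in>{w. norm w < 1 \<and> norm w \<ge> 1 - h}. nevanlinna2 \<phi> w) \<le> ennreal (100 * rho2 \<phi> (100 * h))"
    if "0 < h \<and> h < 1 \<and> h < h0" for h
  proof
    have h: "0 < h" "h < 1/200" "5 * h < 1 - norm (\<phi> z0)" using that by (auto simp: h0_def)
    have away: "norm (\<phi> z) < 1 - 5 * h" if "z \<in> cball 0 (1/2)" for z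
      using z0(2)[OF that] h by linarith
    have \<phi>0: "norm (\<phi> 0) < 1 - h" using away[of 0] h by simp
    let ?S = "SUP w\<in>{w. norm w < 1 \<and> norm w \<ge> 1 - h}. nevanlinna2 \<phi> w"
    show "?S \<le> ennreal (100 * rho2 \<phi> (100 * h))"
      by (rule SUP_least) (use counting_le_window[OF hol maps h(1,2) away] in auto)
    show "ennreal (rho2 \<phi> (h / 100) / 100) \<le> ?S"
    \<comment> \<open>The lower estimate needs a finite bound s; if the supremum is infinite there
      is nothing to prove.\<close>
    proof (cases ?S rule: ennreal_cases)
      case (real s)
      have "rho2 \<phi> (h / 100) \<le> 100 * s"
        unfolding rho2_def
      proof (rule cSUP_least)
        fix \<xi> :: complex assume "\<xi> \<in> sphere 0 1"
        then have "norm \<xi> = 1" by simp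
        then show "area_meas {z. norm z < 1 \<and> \<phi> z \<in> carleson_window \<xi> (h / 100)} \<le> 100 * s"
        proof (rule window_le_counting[OF hol maps h(1) \<phi>0 _ real(1)])
          fix w :: complex assume "norm w < 1" "norm w \<ge> 1 - h"
          then show "nevanlinna2 \<phi> w \<le> ennreal s"
            unfolding real(2)[symmetric] by (intro SUP_upper) auto
        qed
      qed simp
      then show ?thesis unfolding real(2) by (intro ennreal_leI) simp
    next
      case top
      show ?thesis unfolding top by simp
    qed
  qed
  ultimately show "\<exists>h0>0. \<forall>h::real. 0 < h \<and> h < 1 \<and> h < h0 \<longrightarrow>
      ennreal (rho2 \<phi> (h / 100) / 100) \<le> (SUP w\<in>{w. norm w < 1 \<and> norm w \<ge> 1 - h}. nevanlinna2 \<phi> w)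
      \<and> (SUP w\<in>{w. norm w < 1 \<and> norm w \<ge> 1 - h}. nevanlinna2 \<phi> w) \<le> ennreal (100 * rho2 \<phi> (100 * h))"
    by blast
qed simp

end
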